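(* For every natural number $n>0$ the functor $F_n : \mathbf{Set}\to\mathbf{Set}$, $I \mapsto I^n$, is a tripos. Moreover, for natural numbers $n,m>0$, the triposes $F_n^*\mathsf{Sub}_{\mathbf{Set}}$ and $F_m^*\mathsf{Sub}_{\mathbf{Set}}$ are equivalent if and only if $n=m$.
   Context: "Topos" means elementary topos. A tripos over a topos $\mathcal{S}$ is a finite limit preserving functor $F : \mathcal{S}\to\mathcal{E}$ to a topos $\mathcal{E}$ such that every object $A$ of $\mathcal{E}$ appears as a subquotient of $FI$ for some object $I$ of $\mathcal{S}$, i.e. there are a mono $m : C \rightarrowtail FI$ and an epi $e : C \twoheadrightarrow A$ in $\mathcal{E}$. For a topos $\mathcal{E}$, $\mathsf{Sub}_{\mathcal{E}}$ denotes the subobject fibration over $\mathcal{E}$, whose fiber over $X$ is the poset (or equivalent preorder) of subobjects of $X$, with reindexing given by pullback. For a tripos $F:\mathcal{S}\to\mathcal{E}$, $F^*\mathsf{Sub}_{\mathcal{E}}$ denotes the fibered preorder over $\mathcal{S}$ obtained from $\mathsf{Sub}_{\mathcal{E}}$ by change of base along $F$: its fiber over $I$ is $\mathsf{Sub}_{\mathcal{E}}(FI)$, and reindexing along $u : J\to I$ in $\mathcal{S}$ is pullback along $Fu$. The tripos $F$ and the fibered preorder $F^*\mathsf{Sub}_{\mathcal{E}}$ are regarded as two presentations of the same tripos, and $F^*\mathsf{Sub}_{\mathcal{E}}$ and $G^*\mathsf{Sub}_{\mathcal{F}}$ (for triposes $F : \mathcal{S}\to\mathcal{E}$ and $G:\mathcal{S}\to\mathcal{F}$)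 are called equivalent if they are equivalent as fibered preorders over $\mathcal{S}$ (i.e. via fiberwise equivalences of preorders compatible, up to isomorphism, with reindexing). *)

theory Defs
  imports "HOL-Library.FuncSet"
begin

section \<open>Categories and functors\<close>

record ('o, 'a) cat =
  Ob :: "'o set"
  Arr :: "'a set"
  Dom :: "'a \<Rightarrow> 'o"
  Cod :: "'a \<Rightarrow> 'o"
  Ident :: "'o \<Rightarrow> 'a"
  Comp :: "'a \<Rightarrow> 'a \<Rightarrow> 'a"  (infixl "\<cdot>\<index>" 70)

definition hom :: "('o, 'a) cat \<Rightarrow> 'o \<Rightarrow> 'o \<Rightarrow> 'a set" where
  "hom C a b = {f \<in> Arr C. Dom C f = a \<and> Cod C f = b}"

locale category =
  fixes C :: "('o, 'a) cat" (structure)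
  assumes Dom_in: "f \<in> Arr C \<Longrightarrow> Dom C f \<in> Ob C"
    and Cod_in: "f \<in> Arr C \<Longrightarrow> Cod C f \<in> Ob C"
    and Ident_in: "a \<in> Ob C \<Longrightarrow> Ident C a \<in> hom C a a"
    and Comp_in: "\<lbrakk>f \<in> hom C a b; g \<in> hom C b c\<rbrakk> \<Longrightarrow> g \<cdot> f \<in> hom C a c"
    and Comp_Ident: "f \<in> hom C a b \<Longrightarrow> f \<cdot> Ident C a = f"
    and Ident_Comp: "f \<in> hom C a b \<Longrightarrow> Ident C b \<cdot> f = f"
    and Comp_assoc:
      "\<lbrakk>f \<in> hom C a b; g \<in> hom C b c; h \<in> hom C c d\<rbrakk> \<Longrightarrow> h \<cdot> (g \<cdot> f) = (h \<cdot> g) \<cdot> f"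

record ('o1, 'a1, 'o2, 'a2) func =
  FOb :: "'o1 \<Rightarrow> 'o2"
  FArr :: "'a1 \<Rightarrow> 'a2"

locale cat_functor = source: category C + target: category D
  for C :: "('o1, 'a1) cat" and D :: "('o2, 'a2) cat" +
  fixes F :: "('o1, 'a1, 'o2, 'a2) func"
  assumes FOb_in: "a \<in> Ob C \<Longrightarrow> FOb F a \<in> Ob D"
    and FArr_in: "f \<in> hom C a b \<Longrightarrow> FArr F f \<in> hom D (FOb F a) (FOb F b)"
    and FArr_Ident: "a \<in> Ob C \<Longrightarrow> FArr F (Ident C a) = Ident D (FOb F a)"
    and FArr_Comp: "\<lbrakk>f \<in> hom C a b; g \<in> hom C b c\<rbrakk>
      \<Longrightarrow> FArr F (g \<cdot>\<^bsub>C\<^esub> f) = FArr F g \<cdot>\<^bsub>D\<^esub> FArr F f"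

definition func_comp ::
  "('o2, 'a2, 'o3, 'a3) func \<Rightarrow> ('o1, 'a1, 'o2, 'a2) func \<Rightarrow> ('o1, 'a1, 'o3, 'a3) func" where
  "func_comp G F = \<lparr>FOb = FOb G \<circ> FOb F, FArr = FArr G \<circ> FArr F\<rparr>"

definition mono_arr :: "('o, 'a) cat \<Rightarrow> 'a \<Rightarrow> bool" where
  "mono_arr C m \<longleftrightarrow> m \<in> Arr C \<and>
     (\<forall>x. \<forall>g \<in> hom C x (Dom C m). \<forall>h \<in> hom C x (Dom C m). m \<cdot>\<^bsub>C\<^esub> g = m \<cdot>\<^bsub>C\<^esub> h \<longrightarrow> g = h)"

definition epi_arr :: "('o, 'a) cat \<Rightarrow> 'a \<Rightarrow> bool" where
  "epi_arr C e \<longleftrightarrow> e \<in> Arr C \<and>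
     (\<forall>x. \<forall>g \<in> hom C (Cod C e) x. \<forall>h \<in> hom C (Cod C e) x. g \<cdot>\<^bsub>C\<^esub> e = h \<cdot>\<^bsub>C\<^esub> e \<longrightarrow> g = h)"


section \<open>Finite limits\<close>

definition is_cone ::
  "('i, 'j) cat \<Rightarrow> ('o, 'a) cat \<Rightarrow> ('i, 'j, 'o, 'a) func \<Rightarrow> 'o \<Rightarrow> ('i \<Rightarrow> 'a) \<Rightarrow> bool" where
  "is_cone J C D c p \<longleftrightarrow> c \<in> Ob C \<and> (\<forall>i \<in> Ob J. p i \<in> hom C c (FOb D i)) \<and>
     (\<forall>u \<in> Arr J. FArr D u \<cdot>\<^bsub>C\<^esub> p (Dom J u) = p (Cod J u))"

definition is_limit ::
  "('i, 'j) cat \<Rightarrow> ('o, 'a) cat \<Rightarrow> ('i, 'j, 'o, 'a) func \<Rightarrow> 'o \<Rightarrow> ('i \<Rightarrow> 'a) \<Rightarrow> bool" where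
  "is_limit J C D c p \<longleftrightarrow> is_cone J C D c p \<and>
     (\<forall>x q. is_cone J C D x q \<longrightarrow> (\<exists>!h. h \<in> hom C x c \<and> (\<forall>i \<in> Ob J. p i \<cdot>\<^bsub>C\<^esub> h = q i)))"

text \<open>Every finite category is isomorphic to one whose objects and arrows are natural numbers,
  so it suffices to let diagram shapes range over these.\<close>

definition finite_shape :: "(nat, nat) cat \<Rightarrow> bool" where
  "finite_shape J \<longleftrightarrow> category J \<and> finite (Ob J) \<and> finite (Arr J)"

definition has_finite_limits :: "('o, 'a) cat \<Rightarrow> bool" where
  "has_finite_limits C \<longleftrightarrow>
     (\<forall>J D. finite_shape J \<and> cat_functor J C D \<longrightarrow> (\<exists>c p. is_limit J C D c p))"

definition preserves_finite_limits ::
  "('o1, 'a1) cat \<Rightarrow> ('o2, 'a2) cat \<Rightarrow> ('o1, 'a1, 'o2, 'a2) func \<Rightarrow> bool" where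
  "preserves_finite_limits C E F \<longleftrightarrow>
     (\<forall>J D c p. finite_shape J \<and> cat_functor J C D \<and> is_limit J C D c p
        \<longrightarrow> is_limit J E (func_comp F D) (FOb F c) (\<lambda>i. FArr F (p i)))"

definition is_terminal :: "('o, 'a) cat \<Rightarrow> 'o \<Rightarrow> bool" where
  "is_terminal C t \<longleftrightarrow> t \<in> Ob C \<and> (\<forall>x \<in> Ob C. \<exists>!h. h \<in> hom C x t)"

definition is_product :: "('o, 'a) cat \<Rightarrow> 'o \<Rightarrow> 'o \<Rightarrow> 'o \<Rightarrow> 'a \<Rightarrow> 'a \<Rightarrow> bool" where
  "is_product C a b p p1 p2 \<longleftrightarrow> p1 \<in> hom C p a \<and> p2 \<in> hom C p b \<and>
     (\<forall>x. \<forall>f \<in> hom C x a. \<forall>g \<in> hom C x b.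
        \<exists>!h. h \<in> hom C x p \<and> p1 \<cdot>\<^bsub>C\<^esub> h = f \<and> p2 \<cdot>\<^bsub>C\<^esub> h = g)"

definition is_pullback :: "('o, 'a) cat \<Rightarrow> 'a \<Rightarrow> 'a \<Rightarrow> 'a \<Rightarrow> 'a \<Rightarrow> bool" where
  "is_pullback C f g p q \<longleftrightarrow>
     f \<in> Arr C \<and> g \<in> hom C (Dom C g) (Cod C f) \<and>
     p \<in> hom C (Dom C p) (Dom C f) \<and> q \<in> hom C (Dom C p) (Dom C g) \<and>
     f \<cdot>\<^bsub>C\<^esub> p = g \<cdot>\<^bsub>C\<^esub> q \<and>
     (\<forall>x. \<forall>r \<in> hom C x (Dom C f). \<forall>s \<in> hom C x (Dom C g). f \<cdot>\<^bsub>C\<^esub> r = g \<cdot>\<^bsub>C\<^esub> s \<longrightarrow>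
        (\<exists>!h. h \<in> hom C x (Dom C p) \<and> p \<cdot>\<^bsub>C\<^esub> h = r \<and> q \<cdot>\<^bsub>C\<^esub> h = s))"


section \<open>Elementary toposes and triposes\<close>

text \<open>In the following definition \<open>h\<close> is the arrow \<open>g \<times> id\<close> from \<open>x \<times> a\<close> to \<open>e \<times> a\<close>.\<close>

definition is_exponential ::
  "('o, 'a) cat \<Rightarrow> 'o \<Rightarrow> 'o \<Rightarrow> 'o \<Rightarrow> 'o \<Rightarrow> 'a \<Rightarrow> 'a \<Rightarrow> 'a \<Rightarrow> bool" where
  "is_exponential C a b e p p1 p2 ev \<longleftrightarrow>
     is_product C e a p p1 p2 \<and> ev \<in> hom C p b \<and>
     (\<forall>x q q1 q2. \<forall>f \<in> hom C q b. is_product C x a q q1 q2 \<longrightarrow>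
        (\<exists>!g. g \<in> hom C x e \<and>
           (\<exists>h \<in> hom C q p. p1 \<cdot>\<^bsub>C\<^esub> h = g \<cdot>\<^bsub>C\<^esub> q1 \<and> p2 \<cdot>\<^bsub>C\<^esub> h = q2 \<and> ev \<cdot>\<^bsub>C\<^esub> h = f)))"

definition has_exponentials :: "('o, 'a) cat \<Rightarrow> bool" where
  "has_exponentials C \<longleftrightarrow>
     (\<forall>a \<in> Ob C. \<forall>b \<in> Ob C. \<exists>e p p1 p2 ev. is_exponential C a b e p p1 p2 ev)"

definition is_subobject_classifier :: "('o, 'a) cat \<Rightarrow> 'o \<Rightarrow> 'o \<Rightarrow> 'a \<Rightarrow> bool" where
  "is_subobject_classifier C t \<Omega> tr \<longleftrightarrow>
     is_terminal C t \<and> tr \<in> hom C t \<Omega> \<and>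
     (\<forall>m. mono_arr C m \<longrightarrow>
        (\<exists>!\<chi>. \<chi> \<in> hom C (Cod C m) \<Omega> \<and> (\<exists>k \<in> hom C (Dom C m) t. is_pullback C \<chi> tr m k)))"

definition elementary_topos :: "('o, 'a) cat \<Rightarrow> bool" where
  "elementary_topos C \<longleftrightarrow> category C \<and> has_finite_limits C \<and> has_exponentials C \<and>
     (\<exists>t \<Omega> tr. is_subobject_classifier C t \<Omega> tr)"

definition is_subquotient :: "('o, 'a) cat \<Rightarrow> 'o \<Rightarrow> 'o \<Rightarrow> bool" where
  "is_subquotient C a b \<longleftrightarrow>
     (\<exists>c m e. m \<in> hom C c b \<and> mono_arr C m \<and> e \<in> hom C c a \<and> epi_arr C e)"

definition tripos ::
  "('o1, 'a1) cat \<Rightarrow> ('o2, 'a2) cat \<Rightarrow> ('o1, 'a1, 'o2, 'a2) func \<Rightarrow> bool" where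
  "tripos S E F \<longleftrightarrow> elementary_topos S \<and> elementary_topos E \<and> cat_functor S E F \<and>
     preserves_finite_limits S E F \<and> (\<forall>A \<in> Ob E. \<exists>I \<in> Ob S. is_subquotient E A (FOb F I))"


section \<open>Fibered preorders\<close>

text \<open>A fibered preorder is given by its fibers together with a choice of reindexing maps, which
  need to be functorial only up to isomorphism in the fibers.\<close>

record ('o, 'a, 'x) fibpre =
  Fiber :: "'o \<Rightarrow> 'x set"
  Leq :: "'o \<Rightarrow> 'x \<Rightarrow> 'x \<Rightarrow> bool"
  Reidx :: "'a \<Rightarrow> 'x \<Rightarrow> 'x"

definition Iso :: "('o, 'a, 'x) fibpre \<Rightarrow> 'o \<Rightarrow> 'x \<Rightarrow> 'x \<Rightarrow> bool" where
  "Iso P I x y \<longleftrightarrow> Leq P I x y \<and> Leq P I y x"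

locale fibered_preorder = category S
  for S :: "('o, 'a) cat" (structure) +
  fixes P :: "('o, 'a, 'x) fibpre"
  assumes Leq_refl: "\<lbrakk>I \<in> Ob S; x \<in> Fiber P I\<rbrakk> \<Longrightarrow> Leq P I x x"
    and Leq_trans: "\<lbrakk>I \<in> Ob S; x \<in> Fiber P I; y \<in> Fiber P I; z \<in> Fiber P I;
      Leq P I x y; Leq P I y z\<rbrakk> \<Longrightarrow> Leq P I x z"
    and Reidx_in: "\<lbrakk>u \<in> hom S J I; x \<in> Fiber P I\<rbrakk> \<Longrightarrow> Reidx P u x \<in> Fiber P J"
    and Reidx_mono: "\<lbrakk>u \<in> hom S J I; x \<in> Fiber P I; y \<in> Fiber P I; Leq P I x y\<rbrakk>
      \<Longrightarrow> Leq P J (Reidx P u x) (Reidx P u y)"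
    and Reidx_Ident: "\<lbrakk>I \<in> Ob S; x \<in> Fiber P I\<rbrakk> \<Longrightarrow> Iso P I (Reidx P (Ident S I) x) x"
    and Reidx_Comp: "\<lbrakk>v \<in> hom S K J; u \<in> hom S J I; x \<in> Fiber P I\<rbrakk>
      \<Longrightarrow> Iso P K (Reidx P (u \<cdot> v) x) (Reidx P v (Reidx P u x))"

text \<open>Compatibility of the quasi-inverses \<open>\<Psi>\<close> with reindexing follows from that of \<open>\<Phi>\<close>.\<close>

definition fibered_equivalent ::
  "('o, 'a) cat \<Rightarrow> ('o, 'a, 'x) fibpre \<Rightarrow> ('o, 'a, 'y) fibpre \<Rightarrow> bool" where
  "fibered_equivalent S P Q \<longleftrightarrow> fibered_preorder S P \<and> fibered_preorder S Q \<and>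
     (\<exists>\<Phi> \<Psi>.
        (\<forall>I \<in> Ob S.
           \<Phi> I \<in> Fiber P I \<rightarrow> Fiber Q I \<and>
           \<Psi> I \<in> Fiber Q I \<rightarrow> Fiber P I \<and>
           (\<forall>x \<in> Fiber P I. \<forall>y \<in> Fiber P I. Leq P I x y \<longrightarrow> Leq Q I (\<Phi> I x) (\<Phi> I y)) \<and>
           (\<forall>x \<in> Fiber Q I. \<forall>y \<in> Fiber Q I. Leq Q I x y \<longrightarrow> Leq P I (\<Psi> I x) (\<Psi> I y)) \<and>
           (\<forall>x \<in> Fiber P I. Iso P I (\<Psi> I (\<Phi> I x)) x) \<and>
           (\<forall>y \<in> Fiber Q I. Iso Q I (\<Phi> I (\<Psi> I y)) y)) \<and>
        (\<forall>J I. \<forall>u \<in> hom S J I. \<forall>x \<in> Fiber P I.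
           Iso Q J (\<Phi> J (Reidx P u x)) (Reidx Q u (\<Phi> I x))))"

text \<open>The subobject fibration, with subobjects represented by monos, preordered by factorization;
  the reindexing of \<open>m\<close> along \<open>u\<close> is a chosen pullback of \<open>m\<close> along \<open>u\<close>.\<close>

definition Sub :: "('o, 'a) cat \<Rightarrow> ('o, 'a, 'a) fibpre" where
  "Sub E = \<lparr>
     Fiber = (\<lambda>X. {m. mono_arr E m \<and> Cod E m = X}),
     Leq = (\<lambda>X m m'. \<exists>h \<in> hom E (Dom E m) (Dom E m'). m' \<cdot>\<^bsub>E\<^esub> h = m),
     Reidx = (\<lambda>u m. SOME m'. \<exists>k. is_pullback E u m m' k)\<rparr>"

definition base_change ::
  "('o1, 'a1, 'o2, 'a2) func \<Rightarrow> ('o2, 'a2, 'x) fibpre \<Rightarrow> ('o1, 'a1, 'x) fibpre" where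
  "base_change F P = \<lparr>
     Fiber = (\<lambda>I. Fiber P (FOb F I)),
     Leq = (\<lambda>I. Leq P (FOb F I)),
     Reidx = (\<lambda>u. Reidx P (FArr F u))\<rparr>"


section \<open>The category of sets\<close>

text \<open>HOL has no type of all sets, so the universe of sets is an arbitrary type \<open>'v\<close>
  whose elements satisfy the axioms of ZFC. Separation and replacement are in second-order form,
  and choice is inherited from HOL.\<close>

locale zfc_universe =
  fixes elts :: "'v \<Rightarrow> 'v set"
  assumes extensionality: "elts x = elts y \<Longrightarrow> x = y"
    and foundation: "wf {(x, y). x \<in> elts y}"
    and separation: "\<exists>y. elts y = {z \<in> elts x. Q z}"
    and union: "\<exists>y. elts y = \<Union> (elts ` elts x)"
    and powerset: "\<exists>y. elts y = {z. elts z \<subseteq> elts x}"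
    and replacement: "\<exists>y. elts y = f ` elts x"
    and infinity: "\<exists>w. (\<exists>z \<in> elts w. elts z = {}) \<and>
      (\<forall>x \<in> elts w. \<exists>y \<in> elts w. elts y = insert x (elts x))"
begin

text \<open>The set with a given collection of elements, meaningful only if there is such a set.\<close>

definition vset :: "'v set \<Rightarrow> 'v" where
  "vset X = (THE x. elts x = X)"

text \<open>Kuratowski pairs and von Neumann numerals.\<close>

definition vpair :: "'v \<Rightarrow> 'v \<Rightarrow> 'v" where
  "vpair x y = vset {vset {x}, vset {x, y}}"

primrec vnat :: "nat \<Rightarrow> 'v" where
  "vnat 0 = vset {}"
| "vnat (Suc k) = vset (insert (vnat k) (elts (vnat k)))"

text \<open>Arrows of the category of sets are triples (domain, function, codomain), where the function
  is \<open>undefined\<close> outside the domain, so that equality of arrows is equality of functions.\<close>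

definition SET :: "('v, 'v \<times> ('v \<Rightarrow> 'v) \<times> 'v) cat" where
  "SET = \<lparr>
     Ob = UNIV,
     Arr = {(A, f, B). f \<in> elts A \<rightarrow>\<^sub>E elts B},
     Dom = (\<lambda>(A, f, B). A),
     Cod = (\<lambda>(A, f, B). B),
     Ident = (\<lambda>A. (A, \<lambda>x \<in> elts A. x, A)),
     Comp = (\<lambda>(B, g, D) (A, f, B'). (A, compose (elts A) g f, D))\<rparr>"

text \<open>The \<open>n\<close>-tuple \<open>(t 0, \<dots>, t (n - 1))\<close> is the graph of the function with domain
  \<open>{0, \<dots>, n - 1}\<close>, and \<open>ventry\<close> extracts its entries.\<close>

definition vtuple :: "nat \<Rightarrow> (nat \<Rightarrow> 'v) \<Rightarrow> 'v" where
  "vtuple n t = vset ((\<lambda>k. vpair (vnat k) (t k)) ` {..<n})"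

definition ventry :: "'v \<Rightarrow> nat \<Rightarrow> 'v" where
  "ventry s k = (THE x. vpair (vnat k) x \<in> elts s)"

definition vpower :: "'v \<Rightarrow> nat \<Rightarrow> 'v" where
  "vpower I n = vset (vtuple n ` ({..<n} \<rightarrow> elts I))"

definition power_functor ::
  "nat \<Rightarrow> ('v, 'v \<times> ('v \<Rightarrow> 'v) \<times> 'v, 'v, 'v \<times> ('v \<Rightarrow> 'v) \<times> 'v) func" where
  "power_functor n = \<lparr>
     FOb = (\<lambda>I. vpower I n),
     FArr = (\<lambda>(I, f, J). (vpower I n,
       \<lambda>s \<in> elts (vpower I n). vtuple n (\<lambda>k. f (ventry s k)), vpower J n))\<rparr>"

end

end

theory Submission
  imports Defs
begin

text \<open>The fiber of \<open>F\<^sub>n\<^sup>*Sub\<close> over the set \<open>2\<close> is, up to isomorphism, the poset of subsets of the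
  \<open>2^n\<close>-element set \<open>2\<^sup>n\<close>, so it has \<open>2^(2^n)\<close> isomorphism classes. An equivalence of fibered
  preorders preserves this number, and it determines \<open>n\<close>. That \<open>Set\<close> is a topos and that powers
  preserve finite limits is checked elementwise: a map out of \<open>X\<close> subject to pointwise
  conditions exists uniquely iff its value at each element of \<open>X\<close> does, and testing against the
  one-point set shows that every limit in \<open>Set\<close> has the expected elements.\<close>

text \<open>The set \<open>2\<close> is the smallest base that tells exponents apart: for positive
  exponents every power of the empty set is empty and every power of a one-point set has one point,
  so those fibers do not depend on the exponent. Two features of the formal setting shape the rest.
  A fiber consists of monos, not subsets, and has far more elements than isomorphism classes, so it
  cannot be counted directly. Each mono is therefore replaced by its image; factorization becomes
  inclusion, and reindexing, a chosen pullback known only through its universal property, becomes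
  preimage. Moreover a set is an element of an abstract type, so each constructed object (a power,
  an exponential, a limit) requires a proof that its elements form a set. The implication from
  \<open>n = m\<close> is reflexivity, whose content is that the pulled back subobject fibration is
  a fibered preorder.\<close>

lemma fibered_equivalent_refl:
  assumes "fibered_preorder S P"
  shows "fibered_equivalent S P P"
proof -
  interpret fibered_preorder S P by (rule assms)
  have "Iso P I x x" if "I \<in> Ob S" "x \<in> Fiber P I" for I x
    using that by (simp add: Iso_def Leq_refl)
  moreover have "Reidx P u x \<in> Fiber P J" "J \<in> Ob S" if "u \<in> hom S J I" "x \<in> Fiber P I" for u x I J
    using that Reidx_in Dom_in by (auto simp: hom_def)
  ultimately show ?thesis
    unfolding fibered_equivalent_def using assms
    by (intro conjI exI[of _ "\<lambda>I x. x"]) auto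
qed

context zfc_universe
begin

section \<open>Small collections\<close>

definition small :: "'v set \<Rightarrow> bool" where
  "small X \<longleftrightarrow> (\<exists>x. elts x = X)"

lemma small_elts [simp]: "small (elts x)"
  by (auto simp: small_def)

lemma elts_eq_iff: "elts x = elts y \<longleftrightarrow> x = y"
  using extensionality by blast

lemma elts_vset: "small X \<Longrightarrow> elts (vset X) = X"
  unfolding small_def vset_def by (auto simp: elts_eq_iff)

lemma vset_eq_iff: "small X \<Longrightarrow> small Y \<Longrightarrow> vset X = vset Y \<longleftrightarrow> X = Y"
  by (metis elts_vset)

text \<open>Separation is stated for an arbitrary HOL predicate, so membership in \<open>Y\<close>
  can itself serve as the separating property.\<close>

lemma small_subset: "small X \<Longrightarrow> Y \<subseteq> X \<Longrightarrow> small Y"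
proof -
  assume "small X" "Y \<subseteq> X"
  then obtain x where "Y = {z \<in> elts x. z \<in> Y}" unfolding small_def by blast
  then show "small Y" unfolding small_def using separation[of x "\<lambda>z. z \<in> Y"] by metis
qed

lemma small_image: "small X \<Longrightarrow> small (f ` X)"
  unfolding small_def using replacement by metis

lemma small_UN:
  assumes "small X" "\<And>x. x \<in> X \<Longrightarrow> small (G x)"
  shows "small (\<Union>x\<in>X. G x)"
proof -
  obtain x where x: "elts x = (\<lambda>x. vset (G x)) ` X"
    using small_image[OF assms(1)] unfolding small_def by blast
  obtain y where "elts y = \<Union> (elts ` elts x)"
    using union by blast
  also have "\<dots> = (\<Union>x\<in>X. G x)"
    using assms(2) by (auto simp: x elts_vset)
  finally show ?thesis
    unfolding small_def by blast
qed

text \<open>If all members lie inside one set, the collection is a part of the power set of that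
  set. This is how collections of graphs and of tuples are seen to be sets.\<close>

lemma small_if_bounded:
  assumes "small X" "\<And>z. z \<in> Z \<Longrightarrow> elts z \<subseteq> X"
  shows "small Z"
proof -
  obtain x where x: "elts x = X" using assms(1) unfolding small_def by blast
  obtain y where "elts y = {z. elts z \<subseteq> elts x}" using powerset by blast
  then show ?thesis
    using small_subset[OF small_elts, of Z y] assms(2) x by auto
qed

lemma small_empty [simp]: "small {}"
  by (rule small_subset[OF small_elts]) simp

text \<open>Pairing comes from powerset and replacement: \<open>q\<close>, the power set of the
  power set of the empty set, contains the distinct elements \<open>p\<close> and
  \<open>vset {}\<close>, which replacement sends to \<open>x\<close> and \<open>y\<close>.\<close>

lemma small_pair [simp]: "small {x, y}"
proof -
  obtain p where p: "elts p = {z. elts z \<subseteq> elts (vset {})}" using powerset by blast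
  obtain q where q: "elts q = {z. elts z \<subseteq> elts p}" using powerset by blast
  have "vset {} \<in> elts q" "p \<in> elts q" "p \<noteq> vset {}"
    using p q by (auto simp: elts_vset)
  then have "{x, y} \<subseteq> (\<lambda>z. if z = p then x else y) ` elts q"
    by (auto simp: image_iff)
  then show ?thesis
    by (rule small_subset[OF small_image[OF small_elts]])
qed

lemma small_Un [simp]:
  assumes "small X" "small Y"
  shows "small (X \<union> Y)"
proof -
  obtain x y where "elts x = X" "elts y = Y" using assms unfolding small_def by blast
  then show ?thesis using small_UN[OF small_pair[of x y], of elts] by simp
qed

lemma small_insert [simp]: "small X \<Longrightarrow> small (insert x X)"
  using small_Un[OF small_pair[of x x], of X] by simp

lemma small_finite_UN:
  "finite I \<Longrightarrow> (\<And>i. i \<in> I \<Longrightarrow> small (G i)) \<Longrightarrow> small (\<Union>i\<in>I. G i)"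
  by (induction rule: finite_induct) auto

lemma small_finite: "finite X \<Longrightarrow> small X"
  by (induction rule: finite_induct) auto


section \<open>Pairs, numerals, graphs and tuples\<close>

lemma vpair_eq_iff [simp]: "vpair x y = vpair x' y' \<longleftrightarrow> x = x' \<and> y = y'"
proof -
  have "vset {x} = vset {x'} \<longleftrightarrow> x = x'" "vset {x} = vset {x', y'} \<longleftrightarrow> x = x' \<and> x = y'"
    "vset {x, y} = vset {x'} \<longleftrightarrow> x = x' \<and> y = x'"
    "vset {x, y} = vset {x', y'} \<longleftrightarrow> {x, y} = {x', y'}" for x y x' y'
    by (subst vset_eq_iff; auto)+
  then show ?thesis
    unfolding vpair_def by (subst vset_eq_iff) (auto simp: doubleton_eq_iff)
qed

lemma elts_vnat: "elts (vnat n) = vnat ` {..<n}"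
  by (induction n) (simp_all add: elts_vset small_finite lessThan_Suc)

text \<open>Arrows are triples, and splitting quantified arrows into components would hide them from
  the rules about \<open>app\<close> below; \<open>vnat 1\<close> must not be rewritten to \<open>vnat (Suc 0)\<close>.\<close>

declare vnat.simps [simp del] One_nat_def [simp del] split_paired_All [simp del]
  split_paired_Ex [simp del]

lemma elts_vnat_1 [simp]: "elts (vnat 1) = {vnat 0}"
  by (simp add: elts_vnat One_nat_def lessThan_Suc)

lemma elts_vnat_2 [simp]: "elts (vnat 2) = {vnat 0, vnat 1}"
  by (auto simp: elts_vnat less_2_cases_iff One_nat_def)

text \<open>A smaller von Neumann numeral is an element of a larger one, so equality would make a
  set an element of itself, against foundation.\<close>

lemma inj_vnat: "inj vnat"
proof (rule linorder_injI)
  fix i j :: nat assume "i < j"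
  then have "vnat i \<in> elts (vnat j)" by (auto simp: elts_vnat)
  then show "vnat i \<noteq> vnat j"
    using wf_not_refl[OF foundation] by fastforce
qed

lemma vnat_eq_iff [simp]: "vnat i = vnat j \<longleftrightarrow> i = j"
  using inj_vnat by (auto dest: injD)

lemma small_vpair_image: "small X \<Longrightarrow> small Y \<Longrightarrow> small (\<Union>x\<in>X. vpair x ` Y)"
  by (intro small_UN small_image)

text \<open>The points of an exponential must be elements of \<open>'v\<close>, so a HOL function is
  stored as its graph over \<open>a\<close>, from which \<open>vapply\<close> recovers the
  values.\<close>

definition vgraph :: "'v \<Rightarrow> ('v \<Rightarrow> 'v) \<Rightarrow> 'v" where
  "vgraph a f = vset ((\<lambda>x. vpair x (f x)) ` elts a)"

definition vapply :: "'v \<Rightarrow> 'v \<Rightarrow> 'v" where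
  "vapply g x = (THE y. vpair x y \<in> elts g)"

lemma elts_vgraph: "elts (vgraph a f) = (\<lambda>x. vpair x (f x)) ` elts a"
  by (simp add: vgraph_def elts_vset small_image)

lemma vapply_vgraph [simp]: "x \<in> elts a \<Longrightarrow> vapply (vgraph a f) x = f x"
  by (auto simp: vapply_def elts_vgraph)

lemma vgraph_cong: "(\<And>x. x \<in> elts a \<Longrightarrow> f x = g x) \<Longrightarrow> vgraph a f = vgraph a g"
  by (simp add: vgraph_def cong: image_cong)

definition vexp :: "'v \<Rightarrow> 'v \<Rightarrow> 'v" where
  "vexp a b = vset (vgraph a ` (elts a \<rightarrow> elts b))"

lemma elts_vexp: "elts (vexp a b) = vgraph a ` (elts a \<rightarrow> elts b)"
  unfolding vexp_def
proof (rule elts_vset, rule small_if_bounded)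
  show "small (\<Union>x\<in>elts a. vpair x ` elts b)"
    by (intro small_vpair_image small_elts)
qed (fastforce simp: elts_vgraph)

definition vprod :: "'v \<Rightarrow> 'v \<Rightarrow> 'v" where
  "vprod a b = vset (\<Union>x\<in>elts a. vpair x ` elts b)"

lemma elts_vprod: "elts (vprod a b) = (\<Union>x\<in>elts a. vpair x ` elts b)"
  by (simp add: vprod_def elts_vset small_vpair_image)

lemma vpair_in_vprod [simp]: "vpair x y \<in> elts (vprod a b) \<longleftrightarrow> x \<in> elts a \<and> y \<in> elts b"
  by (auto simp: elts_vprod)

lemma vprodE:
  assumes "z \<in> elts (vprod a b)"
  obtains x y where "x \<in> elts a" "y \<in> elts b" "z = vpair x y"
  using assms by (auto simp: elts_vprod)

definition vfst :: "'v \<Rightarrow> 'v" where "vfst p = (THE x. \<exists>y. p = vpair x y)"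

definition vsnd :: "'v \<Rightarrow> 'v" where "vsnd p = (THE y. \<exists>x. p = vpair x y)"

lemma vfst_vpair [simp]: "vfst (vpair x y) = x"
  and vsnd_vpair [simp]: "vsnd (vpair x y) = y"
  by (auto simp: vfst_def vsnd_def)

lemma elts_vtuple: "elts (vtuple n t) = (\<lambda>k. vpair (vnat k) (t k)) ` {..<n}"
  by (simp add: vtuple_def elts_vset small_finite)

lemma ventry_vtuple [simp]: "k < n \<Longrightarrow> ventry (vtuple n t) k = t k"
  by (auto simp: ventry_def elts_vtuple)

lemma vtuple_cong: "(\<And>k. k < n \<Longrightarrow> s k = t k) \<Longrightarrow> vtuple n s = vtuple n t"
  unfolding vtuple_def by (intro arg_cong[of _ _ vset] image_cong) auto

lemma vtuple_eq_iff: "vtuple n s = vtuple n t \<longleftrightarrow> (\<forall>k<n. s k = t k)"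
  by (metis ventry_vtuple vtuple_cong)

text \<open>Tuples are graphs, hence subsets of the product of \<open>n\<close> numerals with
  \<open>U\<close>. Leaving \<open>T\<close> arbitrary lets the same bound serve powers and limits
  of diagrams.\<close>

lemma small_vtuple_image:
  assumes "small U" "T \<subseteq> {..<n} \<rightarrow> U"
  shows "small (vtuple n ` T)"
proof (rule small_if_bounded)
  show "small (\<Union>x \<in> vnat ` {..<n}. vpair x ` U)"
    by (rule small_vpair_image[OF small_finite assms(1)]) simp
  show "elts z \<subseteq> (\<Union>x \<in> vnat ` {..<n}. vpair x ` U)" if "z \<in> vtuple n ` T" for z
    using that assms(2) by (fastforce simp: elts_vtuple)
qed

lemma elts_vpower: "elts (vpower I n) = vtuple n ` ({..<n} \<rightarrow> elts I)"
  unfolding vpower_def by (intro elts_vset small_vtuple_image[OF small_elts]) auto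

lemma vtuple_in_vpower: "vtuple n t \<in> elts (vpower I n) \<longleftrightarrow> (\<forall>k<n. t k \<in> elts I)"
  by (auto simp: elts_vpower image_iff vtuple_eq_iff)

lemma ventry_in: "s \<in> elts (vpower I n) \<Longrightarrow> k < n \<Longrightarrow> ventry s k \<in> elts I"
  by (auto simp: elts_vpower)

lemma vtuple_ventry [simp]: "s \<in> elts (vpower I n) \<Longrightarrow> vtuple n (ventry s) = s"
  by (auto simp: elts_vpower vtuple_eq_iff)

lemma card_vpower: "card (elts (vpower (vnat k) n)) = k ^ n"
proof -
  \<comment> \<open>\<open>vtuple n\<close> reads only the values below \<open>n\<close>, so it is
    injective on extensional functions but not on arbitrary ones.\<close>
  have "bij_betw (vtuple n) (PiE {..<n} (\<lambda>_. elts (vnat k))) (elts (vpower (vnat k) n))"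
  proof (rule bij_betwI)
    show "(\<lambda>s. restrict (ventry s) {..<n}) \<in> elts (vpower (vnat k) n) \<rightarrow> PiE {..<n} (\<lambda>_. elts (vnat k))"
      by (auto intro: ventry_in split: if_splits)
    show "vtuple n (restrict (ventry s) {..<n}) = s" if "s \<in> elts (vpower (vnat k) n)" for s
      using vtuple_cong[of n "restrict (ventry s) {..<n}" "ventry s"] that by simp
    show "restrict (ventry (vtuple n t)) {..<n} = t" if "t \<in> PiE {..<n} (\<lambda>_. elts (vnat k))" for t
      using that by (intro ext) (auto simp: PiE_iff extensional_def split: if_splits)
    show "vtuple n \<in> PiE {..<n} (\<lambda>_. elts (vnat k)) \<rightarrow> elts (vpower (vnat k) n)"
      by (simp add: Pi_iff PiE_iff vtuple_in_vpower)
  qed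
  then show ?thesis
    by (simp add: bij_betw_same_card[symmetric] card_PiE elts_vnat card_image inj_on_def)
qed


section \<open>The category of sets\<close>

definition app :: "'v \<times> ('v \<Rightarrow> 'v) \<times> 'v \<Rightarrow> 'v \<Rightarrow> 'v" where
  "app a = fst (snd a)"

text \<open>The restriction enforces the convention that arrows are \<open>undefined\<close> off
  their domain, so any HOL function with suitable values can be used to build one.\<close>

definition arr :: "'v \<Rightarrow> ('v \<Rightarrow> 'v) \<Rightarrow> 'v \<Rightarrow> 'v \<times> ('v \<Rightarrow> 'v) \<times> 'v" where
  "arr a f b = (a, restrict f (elts a), b)"

lemma Ob_SET [simp]: "Ob SET = UNIV"
  by (simp add: SET_def)

lemma mem_hom_SET:
  "f \<in> hom SET a b \<longleftrightarrow> f = (a, app f, b) \<and> app f \<in> elts a \<rightarrow>\<^sub>E elts b"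
  by (cases f) (auto simp: hom_def SET_def app_def)

lemma app_in: "f \<in> hom SET a b \<Longrightarrow> x \<in> elts a \<Longrightarrow> app f x \<in> elts b"
  by (auto simp: mem_hom_SET)

lemma app_arr [simp]: "x \<in> elts a \<Longrightarrow> app (arr a f b) x = f x"
  by (simp add: app_def arr_def)

lemma arr_in_hom: "arr a f b \<in> hom SET a b \<longleftrightarrow> f \<in> elts a \<rightarrow> elts b"
  by (auto simp: mem_hom_SET app_def arr_def)

lemma Dom_arr [simp]: "Dom SET (arr a f b) = a"
  and Cod_arr [simp]: "Cod SET (arr a f b) = b"
  by (simp_all add: arr_def SET_def)

lemma hom_SET_eq_iff:
  "\<lbrakk>f \<in> hom SET a b; g \<in> hom SET a b\<rbrakk> \<Longrightarrow> f = g \<longleftrightarrow> (\<forall>x\<in>elts a. app f x = app g x)"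
  by (metis mem_hom_SET PiE_ext)

lemma Comp_SET_in: "\<lbrakk>f \<in> hom SET a b; g \<in> hom SET b c\<rbrakk> \<Longrightarrow> g \<cdot>\<^bsub>SET\<^esub> f \<in> hom SET a c"
  by (cases f; cases g) (auto simp: hom_def SET_def compose_def)

lemma app_Comp [simp]:
  "\<lbrakk>f \<in> hom SET a b; g \<in> hom SET b c; x \<in> elts a\<rbrakk> \<Longrightarrow> app (g \<cdot>\<^bsub>SET\<^esub> f) x = app g (app f x)"
  by (cases f; cases g) (auto simp: hom_def SET_def compose_def app_def)

lemma Ident_SET: "Ident SET a = arr a (\<lambda>x. x) a"
  by (simp add: SET_def arr_def)

lemma Ident_SET_in: "Ident SET a \<in> hom SET a a"
  by (simp add: Ident_SET arr_in_hom)

lemma app_Ident [simp]: "x \<in> elts a \<Longrightarrow> app (Ident SET a) x = x"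
  by (simp add: Ident_SET)

lemma category_SET: "category SET"
proof
  show "g \<cdot>\<^bsub>SET\<^esub> f \<in> hom SET a c" if "f \<in> hom SET a b" "g \<in> hom SET b c" for f g a b c
    using that by (rule Comp_SET_in)
  show "f \<cdot>\<^bsub>SET\<^esub> Ident SET a = f" if "f \<in> hom SET a b" for f a b
    by (subst hom_SET_eq_iff[OF Comp_SET_in[OF Ident_SET_in that] that])
      (simp add: app_Comp[OF Ident_SET_in that])
  show "Ident SET b \<cdot>\<^bsub>SET\<^esub> f = f" if "f \<in> hom SET a b" for f a b
    by (subst hom_SET_eq_iff[OF Comp_SET_in[OF that Ident_SET_in] that])
      (simp add: app_Comp[OF that Ident_SET_in] app_in[OF that])
  show "h \<cdot>\<^bsub>SET\<^esub> (g \<cdot>\<^bsub>SET\<^esub> f) = h \<cdot>\<^bsub>SET\<^esub> g \<cdot>\<^bsub>SET\<^esub> f"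
    if f: "f \<in> hom SET a b" and g: "g \<in> hom SET b c" and h: "h \<in> hom SET c d" for f g h a b c d
  proof -
    note gf = Comp_SET_in[OF f g] and hg = Comp_SET_in[OF g h]
    show ?thesis
      by (subst hom_SET_eq_iff[OF Comp_SET_in[OF gf h] Comp_SET_in[OF f hg]])
        (simp add: app_Comp[OF gf h] app_Comp[OF f hg] app_Comp[OF f g] app_Comp[OF g h] app_in[OF f])
  qed
qed (simp_all add: Ident_SET_in)

text \<open>A map of sets is an independent choice of one value at each point. The universal
  properties below ask for a unique arrow satisfying equations, and such equations are pointwise
  conditions \<open>Q\<close>, so each property reduces to unique existence of elements.\<close>

lemma ex1_hom_SET_iff:
  assumes R: "\<And>h. h \<in> hom SET a b \<Longrightarrow> R h \<longleftrightarrow> (\<forall>x\<in>elts a. Q x (app h x))"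
  shows "(\<exists>!h. h \<in> hom SET a b \<and> R h) \<longleftrightarrow> (\<forall>x\<in>elts a. \<exists>!y. y \<in> elts b \<and> Q x y)"
proof
  assume L: "\<exists>!h. h \<in> hom SET a b \<and> R h"
  obtain h where "h \<in> hom SET a b \<and> R h" "\<forall>k. k \<in> hom SET a b \<and> R k \<longrightarrow> k = h"
    by (rule ex1E[OF L])
  then have h: "h \<in> hom SET a b" "R h" and uniq: "\<And>k. k \<in> hom SET a b \<Longrightarrow> R k \<Longrightarrow> k = h" by blast+
  have Q: "\<forall>x\<in>elts a. Q x (app h x)" using R[OF h(1)] h(2) by simp
  show "\<forall>x\<in>elts a. \<exists>!y. y \<in> elts b \<and> Q x y"
  proof (intro ballI ex1I conjI)
    fix x y assume x: "x \<in> elts a" and y: "y \<in> elts b \<and> Q x y"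
    \<comment> \<open>Changing \<open>h\<close> at \<open>x\<close> alone gives another arrow
      satisfying \<open>R\<close>, so uniqueness of \<open>h\<close> forces \<open>y\<close> to be
      the old value.\<close>
    let ?k = "arr a ((app h)(x := y)) b"
    have "?k \<in> hom SET a b" "\<forall>x\<in>elts a. Q x (app ?k x)"
      using h(1) Q y by (auto simp: arr_in_hom app_in)
    then show "y = app h x" using uniq[of ?k] R[of ?k] app_arr[OF x, of "(app h)(x := y)" b] by auto
  qed (use h(1) Q app_in in auto)
next
  assume E: "\<forall>x\<in>elts a. \<exists>!y. y \<in> elts b \<and> Q x y"
  then obtain f where f: "\<And>x. x \<in> elts a \<Longrightarrow> f x \<in> elts b \<and> Q x (f x)" by metis
  then have f_hom: "arr a f b \<in> hom SET a b" by (auto simp: arr_in_hom)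
  show "\<exists>!h. h \<in> hom SET a b \<and> R h"
  proof (rule ex1I[of _ "arr a f b"])
    fix h assume h: "h \<in> hom SET a b \<and> R h"
    then have "app h x = f x" if "x \<in> elts a" for x
      using E f[OF that] that R[of h] app_in[of h a b x] by blast
    then show "h = arr a f b"
      using h f_hom by (simp add: hom_SET_eq_iff[of h a b])
  qed (use f f_hom R in auto)
qed

section \<open>Monos, products and pullbacks in terms of elements\<close>

lemma Comp_SET_eq_iff:
  "\<lbrakk>f \<in> hom SET a b; g \<in> hom SET b c; k \<in> hom SET a c\<rbrakk> \<Longrightarrow>
    g \<cdot>\<^bsub>SET\<^esub> f = k \<longleftrightarrow> (\<forall>x\<in>elts a. app g (app f x) = app k x)"
  by (simp add: hom_SET_eq_iff[of _ a c] Comp_SET_in[of f a b g c] app_Comp[of f a b g c])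

lemma mono_SET_iff:
  assumes m: "m \<in> hom SET a b"
  shows "mono_arr SET m \<longleftrightarrow> inj_on (app m) (elts a)"
proof
  assume "mono_arr SET m"
  moreover have "Dom SET m = a" using m by (simp add: hom_def)
  ultimately have M: "\<forall>x. \<forall>g \<in> hom SET x a. \<forall>h \<in> hom SET x a. m \<cdot>\<^bsub>SET\<^esub> g = m \<cdot>\<^bsub>SET\<^esub> h \<longrightarrow> g = h"
    by (simp add: mono_arr_def)
  show "inj_on (app m) (elts a)"
  proof (rule inj_onI)
    fix x y assume xy: "x \<in> elts a" "y \<in> elts a" "app m x = app m y"
    let ?g = "\<lambda>x. arr (vnat 1) (\<lambda>_. x) a"
    have gx: "?g x \<in> hom SET (vnat 1) a" and gy: "?g y \<in> hom SET (vnat 1) a"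
      using xy by (simp_all add: arr_in_hom)
    then have "m \<cdot>\<^bsub>SET\<^esub> ?g x = m \<cdot>\<^bsub>SET\<^esub> ?g y"
      using xy by (simp add: Comp_SET_eq_iff[OF gx m Comp_SET_in[OF gy m]] app_Comp[OF gy m])
    then have "?g x = ?g y"
      using M gx gy by blast
    then show "x = y" by (simp add: hom_SET_eq_iff[OF gx gy])
  qed
next
  assume inj: "inj_on (app m) (elts a)"
  have "g = h" if g: "g \<in> hom SET x a" and h: "h \<in> hom SET x a"
    and eq: "m \<cdot>\<^bsub>SET\<^esub> g = m \<cdot>\<^bsub>SET\<^esub> h" for g h x
  proof -
    have "app m (app g z) = app m (app h z)" if "z \<in> elts x" for z
      using eq that by (metis app_Comp g h m)
    then show ?thesis
      using inj g h by (auto simp: hom_SET_eq_iff[OF g h] app_in inj_on_eq_iff)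
  qed
  moreover have "m \<in> Arr SET" "Dom SET m = a" using m by (simp_all add: hom_def)
  ultimately show "mono_arr SET m" by (simp add: mono_arr_def)
qed

lemma is_product_SET_iff:
  "is_product SET a b p p1 p2 \<longleftrightarrow> p1 \<in> hom SET p a \<and> p2 \<in> hom SET p b \<and>
    (\<forall>x\<in>elts a. \<forall>y\<in>elts b. \<exists>!z. z \<in> elts p \<and> app p1 z = x \<and> app p2 z = y)"
proof -
  have *: "(\<exists>!h. h \<in> hom SET c p \<and> p1 \<cdot>\<^bsub>SET\<^esub> h = f \<and> p2 \<cdot>\<^bsub>SET\<^esub> h = g) \<longleftrightarrow>
      (\<forall>w\<in>elts c. \<exists>!z. z \<in> elts p \<and> app p1 z = app f w \<and> app p2 z = app g w)"
    if "p1 \<in> hom SET p a" "p2 \<in> hom SET p b" "f \<in> hom SET c a" "g \<in> hom SET c b" for c f g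
    using that by (intro ex1_hom_SET_iff) (auto simp: Comp_SET_eq_iff[of _ c p])
  show ?thesis
  proof (intro iffI)
    assume L: "is_product SET a b p p1 p2"
    then have p: "p1 \<in> hom SET p a" "p2 \<in> hom SET p b" by (simp_all add: is_product_def)
    have "\<exists>!z. z \<in> elts p \<and> app p1 z = x \<and> app p2 z = y" if "x \<in> elts a" "y \<in> elts b" for x y
    proof -
      \<comment> \<open>A pair of elements is a pair of maps from the one-point set, and the
        mediating arrow picks out the wanted element of \<open>p\<close>.\<close>
      let ?f = "arr (vnat 1) (\<lambda>_. x) a" and ?g = "arr (vnat 1) (\<lambda>_. y) b"
      have fg: "?f \<in> hom SET (vnat 1) a" "?g \<in> hom SET (vnat 1) b"
        using that by (simp_all add: arr_in_hom)
      then have "\<exists>!h. h \<in> hom SET (vnat 1) p \<and> p1 \<cdot>\<^bsub>SET\<^esub> h = ?f \<and> p2 \<cdot>\<^bsub>SET\<^esub> h = ?g"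
        using L unfolding is_product_def by blast
      then show ?thesis unfolding *[OF p fg] by simp
    qed
    with p show "p1 \<in> hom SET p a \<and> p2 \<in> hom SET p b \<and>
      (\<forall>x\<in>elts a. \<forall>y\<in>elts b. \<exists>!z. z \<in> elts p \<and> app p1 z = x \<and> app p2 z = y)" by blast
  next
    assume R: "p1 \<in> hom SET p a \<and> p2 \<in> hom SET p b \<and>
      (\<forall>x\<in>elts a. \<forall>y\<in>elts b. \<exists>!z. z \<in> elts p \<and> app p1 z = x \<and> app p2 z = y)"
    then show "is_product SET a b p p1 p2"
      unfolding is_product_def by (simp add: * app_in[of _ _ a] app_in[of _ _ b])
  qed
qed

lemma is_pullback_SET_iff:
  assumes "f \<in> hom SET a c" "g \<in> hom SET b c" "p \<in> hom SET d a" "q \<in> hom SET d b"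
  shows "is_pullback SET f g p q \<longleftrightarrow> (\<forall>z\<in>elts d. app f (app p z) = app g (app q z)) \<and>
    (\<forall>x\<in>elts a. \<forall>y\<in>elts b. app f x = app g y \<longrightarrow> (\<exists>!z. z \<in> elts d \<and> app p z = x \<and> app q z = y))"
    (is "?L \<longleftrightarrow> ?R")
proof -
  have DC: "Dom SET f = a" "Cod SET f = c" "Dom SET g = b" "Cod SET g = c"
    "Dom SET p = d" "f \<in> Arr SET"
    using assms by (auto simp: hom_def)
  have *: "(\<exists>!h. h \<in> hom SET x d \<and> p \<cdot>\<^bsub>SET\<^esub> h = r \<and> q \<cdot>\<^bsub>SET\<^esub> h = s) \<longleftrightarrow>
      (\<forall>w\<in>elts x. \<exists>!z. z \<in> elts d \<and> app p z = app r w \<and> app q z = app s w)"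
    if "r \<in> hom SET x a" "s \<in> hom SET x b" for x r s
    using that assms by (intro ex1_hom_SET_iff) (auto simp: Comp_SET_eq_iff[of _ x d])
  have comm: "f \<cdot>\<^bsub>SET\<^esub> r = g \<cdot>\<^bsub>SET\<^esub> s \<longleftrightarrow> (\<forall>w\<in>elts x. app f (app r w) = app g (app s w))"
    if "r \<in> hom SET x a" "s \<in> hom SET x b" for r s x
    using that assms
    by (simp add: Comp_SET_eq_iff[OF that(1) assms(1) Comp_SET_in[OF that(2) assms(2)]]
        app_Comp[OF that(2) assms(2)])
  have L: "?L \<longleftrightarrow> (\<forall>z\<in>elts d. app f (app p z) = app g (app q z)) \<and>
     (\<forall>x. \<forall>r \<in> hom SET x a. \<forall>s \<in> hom SET x b. (\<forall>w\<in>elts x. app f (app r w) = app g (app s w)) \<longrightarrow>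
        (\<forall>w\<in>elts x. \<exists>!z. z \<in> elts d \<and> app p z = app r w \<and> app q z = app s w))"
    using assms by (simp add: is_pullback_def DC comm * cong: ball_cong)
  show ?thesis
  proof
    assume ?L
    note L' = conjunct2[OF \<open>?L\<close>[unfolded L], rule_format, where x = "vnat 1"]
    have "\<exists>!z. z \<in> elts d \<and> app p z = x \<and> app q z = y"
      if "x \<in> elts a" "y \<in> elts b" "app f x = app g y" for x y
      using L'[of "arr (vnat 1) (\<lambda>_. x) a" "arr (vnat 1) (\<lambda>_. y) b" "vnat 0"] that
      by (simp add: arr_in_hom)
    then show ?R using \<open>?L\<close> L by blast
  next
    assume ?R
    then show ?L unfolding L by (simp add: app_in[of _ _ a] app_in[of _ _ b])
  qed
qed


section \<open>Limits as sets of compatible families\<close>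

lemma is_cone_SET_iff:
  assumes D: "cat_functor J SET D"
  shows "is_cone J SET D c p \<longleftrightarrow> (\<forall>i\<in>Ob J. p i \<in> hom SET c (FOb D i)) \<and>
    (\<forall>u\<in>Arr J. \<forall>z\<in>elts c. app (FArr D u) (app (p (Dom J u)) z) = app (p (Cod J u)) z)"
proof -
  interpret D: cat_functor J SET D by (rule D)
  have "FArr D u \<cdot>\<^bsub>SET\<^esub> p (Dom J u) = p (Cod J u) \<longleftrightarrow>
      (\<forall>z\<in>elts c. app (FArr D u) (app (p (Dom J u)) z) = app (p (Cod J u)) z)"
    if u: "u \<in> Arr J" and p: "\<forall>i\<in>Ob J. p i \<in> hom SET c (FOb D i)" for u
  proof (rule Comp_SET_eq_iff)
    show "FArr D u \<in> hom SET (FOb D (Dom J u)) (FOb D (Cod J u))"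
      using u by (intro D.FArr_in) (simp add: hom_def)
  qed (use u p D.source.Dom_in D.source.Cod_in in auto)
  then show ?thesis unfolding is_cone_def by auto
qed

text \<open>On \<open>Ob J\<close>, such families are the cones over \<open>D\<close> from a
  one-point set, and hence the elements that any limit of \<open>D\<close> must have.\<close>

definition compatible :: "('i, 'j) cat \<Rightarrow> ('i, 'j, 'v, 'v \<times> ('v \<Rightarrow> 'v) \<times> 'v) func \<Rightarrow> ('i \<Rightarrow> 'v) \<Rightarrow> bool" where
  "compatible J D t \<longleftrightarrow> (\<forall>i\<in>Ob J. t i \<in> elts (FOb D i)) \<and>
    (\<forall>u\<in>Arr J. app (FArr D u) (t (Dom J u)) = t (Cod J u))"

text \<open>One direction tests the limit against cones with vertex \<open>vnat 1\<close>. For the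
  other, a cone from \<open>x\<close> gives a compatible family at each \<open>w\<close> in
  \<open>x\<close>, and the element realizing it is the value of the mediating map at
  \<open>w\<close>.\<close>

lemma is_limit_SET_iff:
  assumes D: "cat_functor J SET D"
  shows "is_limit J SET D c p \<longleftrightarrow> is_cone J SET D c p \<and>
    (\<forall>t. compatible J D t \<longrightarrow> (\<exists>!z. z \<in> elts c \<and> (\<forall>i\<in>Ob J. app (p i) z = t i)))"
proof -
  interpret D: cat_functor J SET D by (rule D)
  have *: "(\<exists>!h. h \<in> hom SET x c \<and> (\<forall>i\<in>Ob J. p i \<cdot>\<^bsub>SET\<^esub> h = q i)) \<longleftrightarrow>
      (\<forall>w\<in>elts x. \<exists>!z. z \<in> elts c \<and> (\<forall>i\<in>Ob J. app (p i) z = app (q i) w))"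
    if "is_cone J SET D c p" "is_cone J SET D x q" for x q
  proof (rule ex1_hom_SET_iff)
    fix h assume h: "h \<in> hom SET x c"
    have "p i \<cdot>\<^bsub>SET\<^esub> h = q i \<longleftrightarrow> (\<forall>w\<in>elts x. app (p i) (app h w) = app (q i) w)"
      if "i \<in> Ob J" for i
      using \<open>is_cone J SET D c p\<close> \<open>is_cone J SET D x q\<close> that
      by (intro Comp_SET_eq_iff[OF h]) (auto simp: is_cone_def)
    then show "(\<forall>i\<in>Ob J. p i \<cdot>\<^bsub>SET\<^esub> h = q i) \<longleftrightarrow> (\<forall>w\<in>elts x. \<forall>i\<in>Ob J. app (p i) (app h w) = app (q i) w)"
      by auto
  qed
  show ?thesis
  proof (intro iffI conjI allI impI)
    assume "is_limit J SET D c p"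
    then show c: "is_cone J SET D c p" by (simp add: is_limit_def)
    fix t assume t: "compatible J D t"
    let ?q = "\<lambda>i. arr (vnat 1) (\<lambda>_. t i) (FOb D i)"
    have q: "is_cone J SET D (vnat 1) ?q"
      using t by (simp add: is_cone_SET_iff[OF D] compatible_def arr_in_hom)
    have "\<exists>!h. h \<in> hom SET (vnat 1) c \<and> (\<forall>i\<in>Ob J. p i \<cdot>\<^bsub>SET\<^esub> h = ?q i)"
      using \<open>is_limit J SET D c p\<close> q unfolding is_limit_def by blast
    then show "\<exists>!z. z \<in> elts c \<and> (\<forall>i\<in>Ob J. app (p i) z = t i)"
      unfolding *[OF c q] by simp
  next
    assume R: "is_cone J SET D c p \<and>
      (\<forall>t. compatible J D t \<longrightarrow> (\<exists>!z. z \<in> elts c \<and> (\<forall>i\<in>Ob J. app (p i) z = t i)))"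
    have "\<exists>!h. h \<in> hom SET x c \<and> (\<forall>i\<in>Ob J. p i \<cdot>\<^bsub>SET\<^esub> h = q i)" if q: "is_cone J SET D x q" for x q
      unfolding *[OF conjunct1[OF R] q]
    proof (rule ballI)
      fix w assume "w \<in> elts x"
      then have "compatible J D (\<lambda>i. app (q i) w)"
        using q by (auto simp: is_cone_SET_iff[OF D] compatible_def app_in)
      then show "\<exists>!z. z \<in> elts c \<and> (\<forall>i\<in>Ob J. app (p i) z = app (q i) w)" using R by blast
    qed
    then show "is_limit J SET D c p" using R unfolding is_limit_def by blast
  qed
qed

lemma has_finite_limits_SET: "has_finite_limits SET"
  unfolding has_finite_limits_def
proof (intro allI impI, elim conjE)
  fix J :: "(nat, nat) cat" and D
  assume fin: "finite_shape J" and D: "cat_functor J SET D"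
  interpret D: cat_functor J SET D by (rule D)
  \<comment> \<open>The objects of the shape are natural numbers below some \<open>N\<close>, so a
    family indexed by them can be stored as an \<open>N\<close>-tuple.\<close>
  obtain N where N: "Ob J \<subseteq> {..<N}"
    using fin unfolding finite_shape_def finite_nat_set_iff_bounded by blast
  \<comment> \<open>Entries off \<open>Ob J\<close> are pinned to \<open>vnat 0\<close>; otherwise
    several tuples could represent one family and uniqueness in the limit would fail.\<close>
  define T where "T = {t. compatible J D t \<and> (\<forall>i. i \<notin> Ob J \<longrightarrow> t i = vnat 0)}"
  define c where "c = vset (vtuple N ` T)"
  have "small (insert (vnat 0) (\<Union>i\<in>Ob J. elts (FOb D i)))"
    using fin unfolding finite_shape_def by (intro small_insert small_finite_UN) auto
  then have c: "elts c = vtuple N ` T"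
    unfolding c_def by (intro elts_vset small_vtuple_image) (auto simp: T_def compatible_def)
  define p where "p i = arr c (\<lambda>s. ventry s i) (FOb D i)" for i
  have app_p: "app (p i) (vtuple N t) = t i" if "i \<in> Ob J" "t \<in> T" for i t
    using that N by (auto simp: p_def c)
  have "is_limit J SET D c p"
    unfolding is_limit_SET_iff[OF D] is_cone_SET_iff[OF D]
  proof (intro conjI ballI allI impI)
    fix i assume "i \<in> Ob J"
    then show "p i \<in> hom SET c (FOb D i)"
      using N by (auto simp: p_def arr_in_hom c T_def compatible_def)
  next
    fix u z assume u: "u \<in> Arr J" and "z \<in> elts c"
    then obtain t where t: "t \<in> T" "z = vtuple N t" by (auto simp: c)
    then show "app (FArr D u) (app (p (Dom J u)) z) = app (p (Cod J u)) z"
      using D.source.Dom_in[OF u] D.source.Cod_in[OF u] u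
      by (simp add: app_p) (simp add: T_def compatible_def)
  next
    fix t assume t: "compatible J D t"
    define t' where "t' i = (if i \<in> Ob J then t i else vnat 0)" for i
    have t': "t' \<in> T"
      using t D.source.Dom_in D.source.Cod_in by (simp add: T_def t'_def compatible_def)
    show "\<exists>!z. z \<in> elts c \<and> (\<forall>i\<in>Ob J. app (p i) z = t i)"
    proof (rule ex1I[of _ "vtuple N t'"])
      show "vtuple N t' \<in> elts c \<and> (\<forall>i\<in>Ob J. app (p i) (vtuple N t') = t i)"
        using t' by (auto simp: c app_p t'_def)
      fix z assume z: "z \<in> elts c \<and> (\<forall>i\<in>Ob J. app (p i) z = t i)"
      then obtain s where s: "s \<in> T" "z = vtuple N s" by (auto simp: c)
      have "s i = t' i" for i
        using z s app_p[of i s] by (cases "i \<in> Ob J") (auto simp: t'_def T_def)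
      then show "z = vtuple N t'" using s by (metis vtuple_cong)
    qed
  qed
  then show "\<exists>c p. is_limit J SET D c p" by blast
qed

text \<open>The exponential is the set of graphs, with application as evaluation. Its universal
  property ranges over all products of \<open>x\<close> and \<open>a\<close>, not only sets of
  Kuratowski pairs, so the elements of \<open>q\<close> are reached through the product property
  alone.\<close>

lemma has_exponentials_SET: "has_exponentials SET"
  unfolding has_exponentials_def
proof (intro ballI)
  fix a b
  define e where "e = vexp a b"
  define p where "p = vprod e a"
  define p1 where "p1 = arr p vfst e"
  define p2 where "p2 = arr p vsnd a"
  define ev where "ev = arr p (\<lambda>z. vapply (vfst z) (vsnd z)) b"
  have p1: "p1 \<in> hom SET p e" and p2: "p2 \<in> hom SET p a" and ev: "ev \<in> hom SET p b"
    by (auto simp: p1_def p2_def ev_def arr_in_hom p_def e_def elts_vexp Pi_iff elim!: vprodE)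
  have prod: "is_product SET e a p p1 p2"
    unfolding is_product_SET_iff
  proof (intro conjI p1 p2 ballI)
    fix x y assume "x \<in> elts e" "y \<in> elts a"
    then show "\<exists>!z. z \<in> elts p \<and> app p1 z = x \<and> app p2 z = y"
      by (intro ex1I[of _ "vpair x y"]) (auto simp: p1_def p2_def p_def elim!: vprodE)
  qed
  have "\<exists>!g. g \<in> hom SET x e \<and>
      (\<exists>h \<in> hom SET q p. p1 \<cdot>\<^bsub>SET\<^esub> h = g \<cdot>\<^bsub>SET\<^esub> q1 \<and> p2 \<cdot>\<^bsub>SET\<^esub> h = q2 \<and> ev \<cdot>\<^bsub>SET\<^esub> h = f)"
    if f: "f \<in> hom SET q b" and "is_product SET x a q q1 q2" for x q q1 q2 f
  proof -
    have q1: "q1 \<in> hom SET q x" and q2: "q2 \<in> hom SET q a"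
      and q: "\<And>w y. w \<in> elts x \<Longrightarrow> y \<in> elts a \<Longrightarrow> \<exists>!z. z \<in> elts q \<and> app q1 z = w \<and> app q2 z = y"
      using that(2) unfolding is_product_SET_iff by blast+
    \<comment> \<open>The arrow \<open>h\<close> is determined by its two components. Eliminating it
      leaves a pointwise condition on \<open>g\<close>, the shape required by
      \<open>ex1_hom_SET_iff\<close>.\<close>
    have "(\<exists>h \<in> hom SET q p. p1 \<cdot>\<^bsub>SET\<^esub> h = g \<cdot>\<^bsub>SET\<^esub> q1 \<and> p2 \<cdot>\<^bsub>SET\<^esub> h = q2 \<and> ev \<cdot>\<^bsub>SET\<^esub> h = f) \<longleftrightarrow>
      (\<forall>w\<in>elts x. \<forall>z\<in>elts q. app q1 z = w \<longrightarrow> vapply (app g w) (app q2 z) = app f z)"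
      (is "?L \<longleftrightarrow> ?R") if g: "g \<in> hom SET x e" for g
    proof -
      note gq1 = Comp_SET_in[OF q1 g]
      have h_iff: "p1 \<cdot>\<^bsub>SET\<^esub> h = g \<cdot>\<^bsub>SET\<^esub> q1 \<and> p2 \<cdot>\<^bsub>SET\<^esub> h = q2 \<and> ev \<cdot>\<^bsub>SET\<^esub> h = f \<longleftrightarrow>
        (\<forall>z\<in>elts q. vfst (app h z) = app g (app q1 z) \<and> vsnd (app h z) = app q2 z \<and>
          vapply (vfst (app h z)) (vsnd (app h z)) = app f z)" if h: "h \<in> hom SET q p" for h
        unfolding Comp_SET_eq_iff[OF h p1 gq1] Comp_SET_eq_iff[OF h p2 q2]
          Comp_SET_eq_iff[OF h ev f]
        using app_in[OF h] by (auto simp: app_Comp[OF q1 g] p1_def p2_def ev_def)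
      show ?thesis
      proof
        assume ?L
        then show ?R using h_iff by (metis (no_types, lifting))
      next
        assume R: ?R
        let ?h = "arr q (\<lambda>z. vpair (app g (app q1 z)) (app q2 z)) p"
        have "?h \<in> hom SET q p"
          using app_in[OF g app_in[OF q1]] app_in[OF q2]
          by (simp add: arr_in_hom p_def)
        moreover from this have "p1 \<cdot>\<^bsub>SET\<^esub> ?h = g \<cdot>\<^bsub>SET\<^esub> q1 \<and> p2 \<cdot>\<^bsub>SET\<^esub> ?h = q2 \<and> ev \<cdot>\<^bsub>SET\<^esub> ?h = f"
          using R app_in[OF q1] by (subst h_iff) auto
        ultimately show ?L by blast
      qed
    qed
    note R = this
    have "\<exists>!\<gamma>. \<gamma> \<in> elts e \<and> (\<forall>z\<in>elts q. app q1 z = w \<longrightarrow> vapply \<gamma> (app q2 z) = app f z)"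
      if w: "w \<in> elts x" for w
    proof -
      \<comment> \<open>\<open>k y\<close> is the element of \<open>q\<close> that plays the role of
        the pair of \<open>w\<close> and \<open>y\<close>; the transpose of \<open>f\<close> at
        \<open>w\<close> is then the graph of \<open>y\<close> mapped to
        \<open>app f (k y)\<close>.\<close>
      obtain k where k: "\<And>y. y \<in> elts a \<Longrightarrow> k y \<in> elts q \<and> app q1 (k y) = w \<and> app q2 (k y) = y"
        using q[OF w] by metis
      have kq2: "k (app q2 z) = z" if "z \<in> elts q" "app q1 z = w" for z
        using k[OF app_in[OF q2 that(1)]] q[OF w app_in[OF q2 that(1)]] that by blast
      show ?thesis
      proof (rule ex1I[of _ "vgraph a (\<lambda>y. app f (k y))"])
        show "vgraph a (\<lambda>y. app f (k y)) \<in> elts e \<and>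
          (\<forall>z\<in>elts q. app q1 z = w \<longrightarrow> vapply (vgraph a (\<lambda>y. app f (k y))) (app q2 z) = app f z)"
          using k app_in[OF f] app_in[OF q2] by (auto simp: e_def elts_vexp kq2)
        fix \<gamma> assume \<gamma>: "\<gamma> \<in> elts e \<and> (\<forall>z\<in>elts q. app q1 z = w \<longrightarrow> vapply \<gamma> (app q2 z) = app f z)"
        then obtain r where r: "\<gamma> = vgraph a r" by (auto simp: e_def elts_vexp)
        have "r y = app f (k y)" if "y \<in> elts a" for y
          using \<gamma> k[OF that] vapply_vgraph[OF that, of r] unfolding r by metis
        then show "\<gamma> = vgraph a (\<lambda>y. app f (k y))" unfolding r by (rule vgraph_cong)
      qed
    qed
    then show ?thesis
      using ex1_hom_SET_iff[of x e, where Q = "\<lambda>w \<gamma>. \<forall>z\<in>elts q. app q1 z = w \<longrightarrow> vapply \<gamma> (app q2 z) = app f z", OF R]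
      by blast
  qed
  then show "\<exists>e p p1 p2 ev. is_exponential SET a b e p p1 p2 ev"
    using prod ev unfolding is_exponential_def by blast
qed

section \<open>The terminal object and the subobject classifier\<close>

lemma is_terminal_SET: "is_terminal SET (vnat 1)"
  unfolding is_terminal_def
proof (intro conjI ballI)
  fix x
  have "(\<exists>!h. h \<in> hom SET x (vnat 1) \<and> True) \<longleftrightarrow> (\<forall>w\<in>elts x. \<exists>!y. y \<in> elts (vnat 1) \<and> True)"
    by (rule ex1_hom_SET_iff) simp
  then show "\<exists>!h. h \<in> hom SET x (vnat 1)" by simp
qed simp

definition im :: "'v \<times> ('v \<Rightarrow> 'v) \<times> 'v \<Rightarrow> 'v set" where
  "im m = app m ` elts (Dom SET m)"

lemma im_hom: "m \<in> hom SET a b \<Longrightarrow> im m = app m ` elts a"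
  by (simp add: im_def hom_def)

text \<open>With truth values \<open>vnat 0\<close> and \<open>vnat 1\<close>, the pullback
  condition says that \<open>\<chi>\<close> is the characteristic function of the image of
  \<open>m\<close>, which determines it.\<close>

lemma is_subobject_classifier_SET:
  "is_subobject_classifier SET (vnat 1) (vnat 2) (arr (vnat 1) (\<lambda>_. vnat 1) (vnat 2))"
  unfolding is_subobject_classifier_def
proof (intro conjI allI impI is_terminal_SET)
  let ?tr = "arr (vnat 1) (\<lambda>_. vnat 1) (vnat 2)"
  show tr: "?tr \<in> hom SET (vnat 1) (vnat 2)" by (simp add: arr_in_hom)
  fix m assume mono: "mono_arr SET m"
  obtain d c where m: "m \<in> hom SET d c" and dc: "Dom SET m = d" "Cod SET m = c"
    using mono by (auto simp: mono_arr_def hom_def)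
  have inj: "inj_on (app m) (elts d)" using mono mono_SET_iff[OF m] by blast
  have R: "(\<exists>k \<in> hom SET d (vnat 1). is_pullback SET \<chi> ?tr m k) \<longleftrightarrow>
      (\<forall>x\<in>elts c. app \<chi> x = vnat 1 \<longleftrightarrow> x \<in> im m)" if \<chi>: "\<chi> \<in> hom SET c (vnat 2)" for \<chi>
  proof -
    have "is_pullback SET \<chi> ?tr m k \<longleftrightarrow> (\<forall>x\<in>elts c. app \<chi> x = vnat 1 \<longleftrightarrow> x \<in> im m)"
      if k: "k \<in> hom SET d (vnat 1)" for k
    proof -
      \<comment> \<open>Since \<open>k\<close> is constant, existence of \<open>z\<close> below is
        membership of \<open>x\<close> in the image, and its uniqueness is injectivity of
        \<open>m\<close>.\<close>
      have "app k z = vnat 0" if "z \<in> elts d" for z using app_in[OF k that] by simp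
      then have "(\<exists>!z. z \<in> elts d \<and> app m z = x \<and> app k z = vnat 0) \<longleftrightarrow> x \<in> im m" for x
        using inj unfolding im_hom[OF m] inj_on_def by blast
      then have "is_pullback SET \<chi> ?tr m k \<longleftrightarrow> (\<forall>z\<in>elts d. app \<chi> (app m z) = vnat 1) \<and>
          (\<forall>x\<in>elts c. app \<chi> x = vnat 1 \<longrightarrow> x \<in> im m)"
        using app_in[OF k] by (simp add: is_pullback_SET_iff[OF \<chi> tr m k])
      then show ?thesis
        using app_in[OF m] unfolding im_hom[OF m] by blast
    qed
    moreover have "\<exists>k. k \<in> hom SET d (vnat 1)"
      using is_terminal_SET unfolding is_terminal_def by auto
    ultimately show ?thesis by blast
  qed
  have "\<exists>!y. y \<in> elts (vnat 2) \<and> (y = vnat 1 \<longleftrightarrow> x \<in> im m)" for x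
    by (rule ex1I[of _ "if x \<in> im m then vnat 1 else vnat 0"]) (auto split: if_splits)
  then show "\<exists>!\<chi>. \<chi> \<in> hom SET (Cod SET m) (vnat 2) \<and>
      (\<exists>k\<in>hom SET (Dom SET m) (vnat 1). is_pullback SET \<chi> ?tr m k)"
    unfolding dc using ex1_hom_SET_iff[of c "vnat 2", where Q = "\<lambda>x y. y = vnat 1 \<longleftrightarrow> x \<in> im m", OF R] by blast
qed

lemma elementary_topos_SET: "elementary_topos SET"
  unfolding elementary_topos_def
  using category_SET has_finite_limits_SET has_exponentials_SET is_subobject_classifier_SET by blast


section \<open>The power functors\<close>

lemma FOb_power [simp]: "FOb (power_functor n) I = vpower I n"
  by (simp add: power_functor_def)

lemma FArr_power:
  "f \<in> hom SET I J \<Longrightarrow> FArr (power_functor n) f =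
    arr (vpower I n) (\<lambda>s. vtuple n (\<lambda>k. app f (ventry s k))) (vpower J n)"
  by (cases f) (auto simp: power_functor_def arr_def app_def hom_def SET_def)

lemma FArr_power_in:
  "f \<in> hom SET I J \<Longrightarrow> FArr (power_functor n) f \<in> hom SET (vpower I n) (vpower J n)"
  by (auto simp: FArr_power arr_in_hom vtuple_in_vpower intro!: app_in[of f I J] ventry_in)

lemma app_FArr_power:
  "f \<in> hom SET I J \<Longrightarrow> s \<in> elts (vpower I n) \<Longrightarrow>
    app (FArr (power_functor n) f) s = vtuple n (\<lambda>k. app f (ventry s k))"
  by (simp add: FArr_power)

lemma cat_functor_power: "cat_functor SET SET (power_functor n)"
proof (intro cat_functor.intro category_SET cat_functor_axioms.intro)
  show "FArr (power_functor n) (Ident SET a) = Ident SET (FOb (power_functor n) a)" for a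
  proof -
    have "app (FArr (power_functor n) (Ident SET a)) s = s" if s: "s \<in> elts (vpower a n)" for s
    proof -
      have "vtuple n (\<lambda>k. app (Ident SET a) (ventry s k)) = vtuple n (ventry s)"
        using ventry_in[OF s] by (intro vtuple_cong) simp
      then show ?thesis using s by (simp add: app_FArr_power[OF Ident_SET_in])
    qed
    then show ?thesis
      by (simp add: hom_SET_eq_iff[OF FArr_power_in[OF Ident_SET_in] Ident_SET_in])
  qed
  fix f g a b c assume f: "f \<in> hom SET a b" and g: "g \<in> hom SET b c"
  note F = FArr_power_in[of _ _ _ n]
  show "FArr (power_functor n) (g \<cdot>\<^bsub>SET\<^esub> f) =
      FArr (power_functor n) g \<cdot>\<^bsub>SET\<^esub> FArr (power_functor n) f"
    by (subst eq_commute, subst Comp_SET_eq_iff[OF F[OF f] F[OF g] F[OF Comp_SET_in[OF f g]]])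
      (auto simp: app_FArr_power[OF f] app_FArr_power[OF g] app_FArr_power[OF Comp_SET_in[OF f g]]
        vtuple_in_vpower vtuple_eq_iff app_Comp[OF f g] ventry_in app_in[OF f])
qed (auto simp: FArr_power_in)

text \<open>Powers are computed coordinatewise: a compatible family in the \<open>n\<close>-th
  powers amounts to \<open>n\<close> compatible families in the original diagram, and the points of
  the limit realizing them are the entries of the required tuple.\<close>

lemma preserves_finite_limits_power: "preserves_finite_limits SET SET (power_functor n)"
  unfolding preserves_finite_limits_def
proof (intro allI impI, elim conjE)
  fix J :: "(nat, nat) cat" and D c p
  assume D: "cat_functor J SET D" and L: "is_limit J SET D c p"
  interpret D: cat_functor J SET D by (rule D)
  interpret F: cat_functor SET SET "power_functor n" by (rule cat_functor_power)
  let ?F = "power_functor n"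
  let ?D = "func_comp ?F D"
  have D': "cat_functor J SET ?D"
  proof unfold_locales
    show "FArr ?D (g \<cdot>\<^bsub>J\<^esub> f) = FArr ?D g \<cdot>\<^bsub>SET\<^esub> FArr ?D f"
      if "f \<in> hom J a b" "g \<in> hom J b c" for f g a b c
      using F.FArr_Comp[OF D.FArr_in[OF that(1)] D.FArr_in[OF that(2)]] D.FArr_Comp[OF that]
      by (simp add: func_comp_def)
  qed (simp_all add: func_comp_def D.FArr_Ident D.FOb_in F.FArr_Ident D.FArr_in FArr_power_in)
  have p: "p i \<in> hom SET c (FOb D i)" if "i \<in> Ob J" for i
    using L that by (simp add: is_limit_def is_cone_def)
  have Du: "FArr D u \<in> hom SET (FOb D (Dom J u)) (FOb D (Cod J u))" if "u \<in> Arr J" for u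
    using that by (intro D.FArr_in) (simp add: hom_def)
  have lim: "\<exists>!z. z \<in> elts c \<and> (\<forall>i\<in>Ob J. app (p i) z = t i)" if "compatible J D t" for t
    using L that unfolding is_limit_SET_iff[OF D] by blast
  show "is_limit J SET ?D (FOb ?F c) (\<lambda>i. FArr ?F (p i))"
    unfolding is_limit_SET_iff[OF D'] FOb_power
  proof (intro conjI allI impI)
    have "FArr ?F (FArr D u) \<cdot>\<^bsub>SET\<^esub> FArr ?F (p (Dom J u)) = FArr ?F (p (Cod J u))" if "u \<in> Arr J" for u
      using F.FArr_Comp[OF p[OF D.source.Dom_in[OF that]] Du[OF that]] L that
      by (simp add: is_limit_def is_cone_def)
    then show "is_cone J SET ?D (vpower c n) (\<lambda>i. FArr ?F (p i))"
      by (simp add: is_cone_def func_comp_def FArr_power_in p)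
    fix t assume t: "compatible J ?D t"
    then have t_in: "t i \<in> elts (vpower (FOb D i) n)" if "i \<in> Ob J" for i
      using that by (simp add: compatible_def func_comp_def)
    have "compatible J D (\<lambda>i. ventry (t i) k)" if k: "k < n" for k
      unfolding compatible_def
    proof (intro conjI ballI)
      show "ventry (t i) k \<in> elts (FOb D i)" if "i \<in> Ob J" for i
        using t_in[OF that] k by (rule ventry_in)
      fix u assume u: "u \<in> Arr J"
      then have "t (Cod J u) = app (FArr ?F (FArr D u)) (t (Dom J u))"
        using t by (simp add: compatible_def func_comp_def)
      also have "\<dots> = vtuple n (\<lambda>k. app (FArr D u) (ventry (t (Dom J u)) k))"
        by (intro app_FArr_power[OF Du[OF u]] t_in D.source.Dom_in u)
      finally show "app (FArr D u) (ventry (t (Dom J u)) k) = ventry (t (Cod J u)) k"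
        using k by simp
    qed
    then have "\<exists>!z. z \<in> elts c \<and> (\<forall>i\<in>Ob J. app (p i) z = ventry (t i) k)" if "k < n" for k
      using lim that by blast
    then obtain z where z: "\<And>k. k < n \<Longrightarrow> z k \<in> elts c \<and> (\<forall>i\<in>Ob J. app (p i) (z k) = ventry (t i) k)"
      and uniq: "\<And>k w. k < n \<Longrightarrow> w \<in> elts c \<Longrightarrow> \<forall>i\<in>Ob J. app (p i) w = ventry (t i) k \<Longrightarrow> w = z k"
      by metis
    have eq_t: "app (FArr ?F (p i)) s = t i \<longleftrightarrow> (\<forall>k<n. app (p i) (ventry s k) = ventry (t i) k)"
      if "i \<in> Ob J" "s \<in> elts (vpower c n)" for i s
      using that t_in[of i]
      by (metis (no_types, lifting) app_FArr_power p vtuple_eq_iff vtuple_ventry)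
    show "\<exists>!s. s \<in> elts (vpower c n) \<and> (\<forall>i\<in>Ob J. app (FArr ?F (p i)) s = t i)"
    proof (rule ex1I[of _ "vtuple n z"])
      show "vtuple n z \<in> elts (vpower c n) \<and> (\<forall>i\<in>Ob J. app (FArr ?F (p i)) (vtuple n z) = t i)"
        using z by (simp add: vtuple_in_vpower eq_t)
      fix s assume s: "s \<in> elts (vpower c n) \<and> (\<forall>i\<in>Ob J. app (FArr ?F (p i)) s = t i)"
      then have "ventry s k = z k" if "k < n" for k
        using that by (intro uniq) (auto simp: eq_t ventry_in)
      then have "vtuple n (ventry s) = vtuple n z" by (rule vtuple_cong)
      then show "s = vtuple n z" using s vtuple_ventry[of s c n] by metis
    qed
  qed
qed

text \<open>The diagonal \<open>A \<rightarrow> A\<^sup>n\<close> already exhibits \<open>A\<close> as a subobject of \<open>A\<^sup>n\<close>.\<close>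

lemma is_subquotient_power:
  assumes "n > 0"
  shows "is_subquotient SET A (vpower A n)"
proof -
  let ?m = "arr A (\<lambda>x. vtuple n (\<lambda>_. x)) (vpower A n)"
  have m: "?m \<in> hom SET A (vpower A n)" by (simp add: arr_in_hom vtuple_in_vpower)
  \<comment> \<open>Recovering \<open>x\<close> from its constant tuple takes at least one
    coordinate, which is where \<open>n > 0\<close> enters.\<close>
  have "mono_arr SET ?m"
    using assms by (auto simp: mono_SET_iff[OF m] inj_on_def vtuple_eq_iff)
  moreover have "epi_arr SET (Ident SET A)"
  proof -
    interpret category SET by (rule category_SET)
    have "Cod SET (Ident SET A) = A" by (simp add: Ident_SET)
    then show ?thesis
      using Comp_Ident[of _ A] Ident_SET_in[of A] by (auto simp: epi_arr_def hom_def)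
  qed
  ultimately show ?thesis unfolding is_subquotient_def using m Ident_SET_in by blast
qed

lemma tripos_power: "n > 0 \<Longrightarrow> tripos SET SET (power_functor n)"
  unfolding tripos_def
  using elementary_topos_SET cat_functor_power[of n] preserves_finite_limits_power[of n]
    is_subquotient_power[of n] by (metis FOb_power Ob_SET UNIV_I)


section \<open>Subobjects as subsets\<close>

lemma mem_Fiber_Sub: "m \<in> Fiber (Sub SET) X \<longleftrightarrow>
    m \<in> hom SET (Dom SET m) X \<and> inj_on (app m) (elts (Dom SET m))"
proof -
  have "mono_arr SET m \<and> Cod SET m = X \<longleftrightarrow> m \<in> hom SET (Dom SET m) X \<and> mono_arr SET m"
    by (auto simp: hom_def mono_arr_def)
  then show ?thesis
    using mono_SET_iff[of m "Dom SET m" X] by (auto simp: Sub_def)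
qed

lemma im_subset: "m \<in> Fiber (Sub SET) X \<Longrightarrow> im m \<subseteq> elts X"
  using app_in[of m "Dom SET m" X] by (auto simp: im_def mem_Fiber_Sub)

text \<open>A factorization exists as soon as \<open>m'\<close> attains every value of
  \<open>m\<close>: choosing a preimage for each point gives the factor.\<close>

lemma Leq_Sub_iff:
  assumes "m \<in> Fiber (Sub SET) X" "m' \<in> Fiber (Sub SET) X"
  shows "Leq (Sub SET) X m m' \<longleftrightarrow> im m \<subseteq> im m'"
proof -
  have m: "m \<in> hom SET (Dom SET m) X" and m': "m' \<in> hom SET (Dom SET m') X"
    using assms by (simp_all add: mem_Fiber_Sub)
  have "Leq (Sub SET) X m m' \<longleftrightarrow> (\<exists>h \<in> hom SET (Dom SET m) (Dom SET m').
      \<forall>z\<in>elts (Dom SET m). app m' (app h z) = app m z)" (is "_ \<longleftrightarrow> ?E")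
    by (simp add: Sub_def Comp_SET_eq_iff[OF _ m' m] cong: bex_cong)
  also have "\<dots> \<longleftrightarrow> im m \<subseteq> im m'"
  proof
    assume ?E
    then obtain h where h: "h \<in> hom SET (Dom SET m) (Dom SET m')"
      "\<forall>z\<in>elts (Dom SET m). app m' (app h z) = app m z" by blast
    show "im m \<subseteq> im m'"
      unfolding im_def using h(2) app_in[OF h(1)] by (metis image_eqI image_subsetI)
  next
    assume "im m \<subseteq> im m'"
    then have "\<forall>z\<in>elts (Dom SET m). \<exists>w\<in>elts (Dom SET m'). app m' w = app m z"
      unfolding im_def by (metis imageE image_eqI subset_iff)
    then obtain h where "\<forall>z\<in>elts (Dom SET m). h z \<in> elts (Dom SET m') \<and> app m' (h z) = app m z"
      by metis
    then show ?E by (intro bexI[of _ "arr (Dom SET m) h (Dom SET m')"]) (auto simp: arr_in_hom)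
  qed
  finally show ?thesis .
qed

lemma Iso_Sub_iff:
  "\<lbrakk>m \<in> Fiber (Sub SET) X; m' \<in> Fiber (Sub SET) X\<rbrakk> \<Longrightarrow> Iso (Sub SET) X m m' \<longleftrightarrow> im m = im m'"
  by (auto simp: Iso_def Leq_Sub_iff)

text \<open>A canonical mono for each subset of \<open>X\<close>, inverse to \<open>im\<close> up to
  isomorphism in the fiber.\<close>

definition incl :: "'v \<Rightarrow> 'v set \<Rightarrow> 'v \<times> ('v \<Rightarrow> 'v) \<times> 'v" where
  "incl X A = arr (vset A) (\<lambda>x. x) X"

lemma
  assumes "A \<subseteq> elts X"
  shows incl_in_Fiber: "incl X A \<in> Fiber (Sub SET) X"
    and im_incl: "im (incl X A) = A"
proof -
  have A: "elts (vset A) = A" using assms by (intro elts_vset small_subset[OF small_elts])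
  then show "incl X A \<in> Fiber (Sub SET) X"
    using assms by (auto simp: incl_def mem_Fiber_Sub arr_in_hom inj_on_def)
  show "im (incl X A) = A"
    using A by (auto simp: incl_def im_def image_iff)
qed

text \<open>\<open>Reidx\<close> takes some pullback by Hilbert choice. One pullback is exhibited so
  that the choice is meaningful; the claims are then derived from the universal property of
  whichever pullback was chosen.\<close>

lemma
  assumes u: "u \<in> hom SET J X" and m: "m \<in> Fiber (Sub SET) X"
  shows Reidx_Sub_in: "Reidx (Sub SET) u m \<in> Fiber (Sub SET) J"
    and im_Reidx_Sub: "im (Reidx (Sub SET) u m) = {x \<in> elts J. app u x \<in> im m}"
proof -
  let ?m' = "Reidx (Sub SET) u m"
  have mh: "m \<in> hom SET (Dom SET m) X" and inj: "inj_on (app m) (elts (Dom SET m))"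
    using m by (simp_all add: mem_Fiber_Sub)
  have "\<exists>m' k. is_pullback SET u m m' k"
  proof -
    \<comment> \<open>The witness is the inclusion of the preimage of \<open>im m\<close>. Its
      second projection \<open>k\<close> chooses preimages under \<open>m\<close>, which are unique
      because \<open>m\<close> is injective.\<close>
    define A where "A = {x \<in> elts J. app u x \<in> im m}"
    have A: "elts (vset A) = A"
      by (rule elts_vset, rule small_subset[OF small_elts[of J]]) (auto simp: A_def)
    have "\<forall>x\<in>A. \<exists>z. z \<in> elts (Dom SET m) \<and> app m z = app u x"
      by (force simp: A_def im_def)
    then obtain k where k: "\<And>x. x \<in> A \<Longrightarrow> k x \<in> elts (Dom SET m) \<and> app m (k x) = app u x"
      by metis
    have p: "arr (vset A) (\<lambda>x. x) J \<in> hom SET (vset A) J" "arr (vset A) k (Dom SET m) \<in> hom SET (vset A) (Dom SET m)"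
      using k A by (auto simp: arr_in_hom A_def)
    have "is_pullback SET u m (arr (vset A) (\<lambda>x. x) J) (arr (vset A) k (Dom SET m))"
      unfolding is_pullback_SET_iff[OF u mh p]
    proof (intro conjI ballI impI)
      fix x y assume xy: "x \<in> elts J" "y \<in> elts (Dom SET m)" "app u x = app m y"
      then have "x \<in> A" by (simp add: A_def im_def)
      moreover from this have "k x = y" using k[of x] xy inj_onD[OF inj, of "k x" y] by simp
      ultimately show "\<exists>!z. z \<in> elts (vset A) \<and> app (arr (vset A) (\<lambda>x. x) J) z = x \<and>
          app (arr (vset A) k (Dom SET m)) z = y"
        by (intro ex1I[of _ x]) (auto simp: A)
    qed (simp add: A k)
    then show ?thesis by blast
  qed
  then have "\<exists>k. is_pullback SET u m ?m' k"
    unfolding Sub_def by (simp add: someI_ex[of "\<lambda>m'. \<exists>k. is_pullback SET u m m' k"])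
  then obtain k where pb: "is_pullback SET u m ?m' k" by blast
  moreover have "Dom SET u = J" using u by (simp add: hom_def)
  ultimately have m'h: "?m' \<in> hom SET (Dom SET ?m') J" and kh: "k \<in> hom SET (Dom SET ?m') (Dom SET m)"
    by (simp_all add: is_pullback_def)
  have comm: "\<And>z. z \<in> elts (Dom SET ?m') \<Longrightarrow> app u (app ?m' z) = app m (app k z)"
    and univ: "\<And>x y. \<lbrakk>x \<in> elts J; y \<in> elts (Dom SET m); app u x = app m y\<rbrakk> \<Longrightarrow>
      \<exists>!z. z \<in> elts (Dom SET ?m') \<and> app ?m' z = x \<and> app k z = y"
    using pb unfolding is_pullback_SET_iff[OF u mh m'h kh] by blast+
  have "inj_on (app ?m') (elts (Dom SET ?m'))"
  proof (rule inj_onI)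
    fix z w assume zw: "z \<in> elts (Dom SET ?m')" "w \<in> elts (Dom SET ?m')" "app ?m' z = app ?m' w"
    then have "app k z = app k w"
      using comm[of z] comm[of w] inj app_in[OF kh] by (simp add: inj_on_eq_iff)
    then show "z = w"
      using univ[OF app_in[OF m'h zw(1)] app_in[OF kh zw(1)] comm[OF zw(1)]] zw by metis
  qed
  then show "?m' \<in> Fiber (Sub SET) J" using m'h by (simp add: mem_Fiber_Sub)
  show "im ?m' = {x \<in> elts J. app u x \<in> im m}"
  proof (intro set_eqI iffI)
    fix x assume "x \<in> im ?m'"
    then show "x \<in> {x \<in> elts J. app u x \<in> im m}"
      using comm app_in[OF m'h] app_in[OF kh] by (auto simp: im_def)
  next
    fix x assume "x \<in> {x \<in> elts J. app u x \<in> im m}"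
    then obtain y where "x \<in> elts J" "y \<in> elts (Dom SET m)" "app u x = app m y"
      by (auto simp: im_def)
    from ex1_implies_ex[OF univ[OF this]] show "x \<in> im ?m'" by (auto simp: im_def)
  qed
qed

text \<open>After passing to images, the laws become monotonicity and functoriality of taking
  preimages, combined with functoriality of \<open>F\<close>.\<close>

lemma fibered_preorder_base_change_Sub:
  assumes "cat_functor SET SET F"
  shows "fibered_preorder SET (base_change F (Sub SET))"
proof -
  interpret F: cat_functor SET SET F by (rule assms)
  note [simp] = Leq_Sub_iff Iso_Sub_iff
  show ?thesis
  proof
    show "Reidx (base_change F (Sub SET)) u x \<in> Fiber (base_change F (Sub SET)) J"
      if "u \<in> hom SET J I" "x \<in> Fiber (base_change F (Sub SET)) I" for u x I J
      using that Reidx_Sub_in[OF F.FArr_in] by (simp add: base_change_def)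
    show "Leq (base_change F (Sub SET)) J (Reidx (base_change F (Sub SET)) u x)
        (Reidx (base_change F (Sub SET)) u y)"
      if "u \<in> hom SET J I" "x \<in> Fiber (base_change F (Sub SET)) I"
        "y \<in> Fiber (base_change F (Sub SET)) I" "Leq (base_change F (Sub SET)) I x y" for u x y I J
      using that F.FArr_in[OF that(1)]
      by (auto simp: base_change_def Reidx_Sub_in im_Reidx_Sub)
    show "Iso (base_change F (Sub SET)) I (Reidx (base_change F (Sub SET)) (Ident SET I) x) x"
      if "x \<in> Fiber (base_change F (Sub SET)) I" for x I
      using that im_subset[of x "FOb F I"]
      by (auto simp: base_change_def Iso_def F.FArr_Ident Reidx_Sub_in[OF Ident_SET_in]
          im_Reidx_Sub[OF Ident_SET_in])
    show "Iso (base_change F (Sub SET)) K (Reidx (base_change F (Sub SET)) (u \<cdot>\<^bsub>SET\<^esub> v) x)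
        (Reidx (base_change F (Sub SET)) v (Reidx (base_change F (Sub SET)) u x))"
      if v: "v \<in> hom SET K J" and u: "u \<in> hom SET J I"
        and x: "x \<in> Fiber (base_change F (Sub SET)) I" for u v x I J K
    proof -
      note Fv = F.FArr_in[OF v] and Fu = F.FArr_in[OF u]
      note Fuv = Comp_SET_in[OF Fv Fu]
      have x': "x \<in> Fiber (Sub SET) (FOb F I)" using x by (simp add: base_change_def)
      note R = Reidx_Sub_in[OF Fu x']
      show ?thesis
        using app_in[OF Fv]
        by (auto simp: base_change_def Iso_def F.FArr_Comp[OF v u] Reidx_Sub_in[OF Fuv x']
            Reidx_Sub_in[OF Fv R] im_Reidx_Sub[OF Fuv x'] im_Reidx_Sub[OF Fv R]
            im_Reidx_Sub[OF Fu x'] app_Comp[OF Fv Fu])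
    qed
  qed (auto simp: base_change_def)
qed

text \<open>\<open>\<Phi>\<close> induces an injection on subsets: if two results have the same
  image, they are isomorphic over \<open>Y\<close>, monotonicity of \<open>\<Psi>\<close> makes
  their values isomorphic over \<open>X\<close>, and \<open>iso\<close> leads back to the original
  subsets. A one-sided inverse thus gives an inequality of cardinalities.\<close>

lemma card_Pow_le_if_Sub_retract:
  assumes "\<Phi> \<in> Fiber (Sub SET) X \<rightarrow> Fiber (Sub SET) Y"
    and "\<Psi> \<in> Fiber (Sub SET) Y \<rightarrow> Fiber (Sub SET) X"
    and mono: "\<And>x y. \<lbrakk>x \<in> Fiber (Sub SET) Y; y \<in> Fiber (Sub SET) Y; Leq (Sub SET) Y x y\<rbrakk>
      \<Longrightarrow> Leq (Sub SET) X (\<Psi> x) (\<Psi> y)"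
    and iso: "\<And>x. x \<in> Fiber (Sub SET) X \<Longrightarrow> Iso (Sub SET) X (\<Psi> (\<Phi> x)) x"
    and "finite (elts Y)"
  shows "card (Pow (elts X)) \<le> card (Pow (elts Y))"
proof (rule card_inj_on_le)
  have \<Phi>: "\<Phi> (incl X A) \<in> Fiber (Sub SET) Y" and \<Psi>: "\<Psi> (\<Phi> (incl X A)) \<in> Fiber (Sub SET) X"
    if "A \<subseteq> elts X" for A
    using that assms(1,2) incl_in_Fiber by blast+
  show "inj_on (\<lambda>A. im (\<Phi> (incl X A))) (Pow (elts X))"
  proof (rule inj_onI)
    fix A B assume "A \<in> Pow (elts X)" "B \<in> Pow (elts X)"
      and eq: "im (\<Phi> (incl X A)) = im (\<Phi> (incl X B))"
    then have AB: "A \<subseteq> elts X" "B \<subseteq> elts X" by auto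
    have "im (\<Psi> (\<Phi> (incl X A))) = im (\<Psi> (\<Phi> (incl X B)))"
      using mono[OF \<Phi>[OF AB(1)] \<Phi>[OF AB(2)]] mono[OF \<Phi>[OF AB(2)] \<Phi>[OF AB(1)]] eq AB
      by (auto simp: Leq_Sub_iff \<Phi> \<Psi>)
    moreover have "im (\<Psi> (\<Phi> (incl X C))) = C" if "C \<subseteq> elts X" for C
      using iso[OF incl_in_Fiber[OF that]]
      by (simp add: Iso_Sub_iff[OF \<Psi>[OF that] incl_in_Fiber[OF that]] im_incl[OF that])
    ultimately show "A = B" using AB by simp
  qed
  show "(\<lambda>A. im (\<Phi> (incl X A))) ` Pow (elts X) \<subseteq> Pow (elts Y)"
    using \<Phi> im_subset by blast
qed (simp add: assms)

lemma power_exponent_eq_if_equivalent: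
  assumes "fibered_equivalent SET (base_change (power_functor n) (Sub SET))
    (base_change (power_functor m) (Sub SET))"
  shows "n = m"
proof -
  let ?X = "vpower (vnat 2) n" and ?Y = "vpower (vnat 2) m"
  obtain \<Phi> \<Psi> where
    "\<Phi> \<in> Fiber (Sub SET) ?X \<rightarrow> Fiber (Sub SET) ?Y"
    "\<Psi> \<in> Fiber (Sub SET) ?Y \<rightarrow> Fiber (Sub SET) ?X"
    "\<And>x y. \<lbrakk>x \<in> Fiber (Sub SET) ?X; y \<in> Fiber (Sub SET) ?X; Leq (Sub SET) ?X x y\<rbrakk>
      \<Longrightarrow> Leq (Sub SET) ?Y (\<Phi> x) (\<Phi> y)"
    "\<And>x y. \<lbrakk>x \<in> Fiber (Sub SET) ?Y; y \<in> Fiber (Sub SET) ?Y; Leq (Sub SET) ?Y x y\<rbrakk>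
      \<Longrightarrow> Leq (Sub SET) ?X (\<Psi> x) (\<Psi> y)"
    "\<And>x. x \<in> Fiber (Sub SET) ?X \<Longrightarrow> Iso (Sub SET) ?X (\<Psi> (\<Phi> x)) x"
    "\<And>y. y \<in> Fiber (Sub SET) ?Y \<Longrightarrow> Iso (Sub SET) ?Y (\<Phi> (\<Psi> y)) y"
  proof -
    from assms obtain \<Phi> \<Psi> where "\<forall>I\<in>Ob SET.
           \<Phi> I \<in> Fiber (Sub SET) (vpower I n) \<rightarrow> Fiber (Sub SET) (vpower I m) \<and>
           \<Psi> I \<in> Fiber (Sub SET) (vpower I m) \<rightarrow> Fiber (Sub SET) (vpower I n) \<and>
           (\<forall>x \<in> Fiber (Sub SET) (vpower I n). \<forall>y \<in> Fiber (Sub SET) (vpower I n). Leq (Sub SET) (vpower I n) x y \<longrightarrow> Leq (Sub SET) (vpower I m) (\<Phi> I x) (\<Phi> I y)) \<and>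
           (\<forall>x \<in> Fiber (Sub SET) (vpower I m). \<forall>y \<in> Fiber (Sub SET) (vpower I m). Leq (Sub SET) (vpower I m) x y \<longrightarrow> Leq (Sub SET) (vpower I n) (\<Psi> I x) (\<Psi> I y)) \<and>
           (\<forall>x \<in> Fiber (Sub SET) (vpower I n). Iso (Sub SET) (vpower I n) (\<Psi> I (\<Phi> I x)) x) \<and>
           (\<forall>y \<in> Fiber (Sub SET) (vpower I m). Iso (Sub SET) (vpower I m) (\<Phi> I (\<Psi> I y)) y)"
      unfolding fibered_equivalent_def base_change_def Iso_def by auto
    then show thesis using that[of "\<Phi> (vnat 2)" "\<Psi> (vnat 2)"] by auto
  qed
  note E = this
  \<comment> \<open>\<open>card\<close> of an infinite set is \<open>0\<close>, so the positive
    value \<open>2 ^ k\<close> already yields finiteness.\<close>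
  have fin: "finite (elts (vpower (vnat 2) k))" for k
    by (rule card_ge_0_finite) (simp add: card_vpower)
  have "card (Pow (elts ?X)) \<le> card (Pow (elts ?Y))"
    by (rule card_Pow_le_if_Sub_retract[OF E(1,2,4,5) fin])
  moreover have "card (Pow (elts ?Y)) \<le> card (Pow (elts ?X))"
    by (rule card_Pow_le_if_Sub_retract[OF E(2,1,3,6) fin])
  \<comment> \<open>The two inequalities give \<open>2 ^ (2 ^ n) = 2 ^ (2 ^ m)\<close>, and
    injectivity of powers of \<open>2\<close>, used twice, gives \<open>n = m\<close>.\<close>
  ultimately show ?thesis
    by (simp add: card_Pow fin card_vpower)
qed

end

theorem theorem3p1:
  fixes elts :: "'v \<Rightarrow> 'v set"
  assumes "zfc_universe elts"
  defines "Set \<equiv> zfc_universe.SET elts"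
    and "F \<equiv> zfc_universe.power_functor elts"
  shows "(\<forall>n::nat. n > 0 \<longrightarrow> tripos Set Set (F n)) \<and>
    (\<forall>n m :: nat. n > 0 \<longrightarrow> m > 0 \<longrightarrow>
      (fibered_equivalent Set (base_change (F n) (Sub Set)) (base_change (F m) (Sub Set))
         \<longleftrightarrow> n = m))"
proof -
  interpret zfc_universe elts by (rule assms(1))
  show ?thesis
    unfolding Set_def F_def
    using tripos_power power_exponent_eq_if_equivalent
      fibered_equivalent_refl[OF fibered_preorder_base_change_Sub[OF cat_functor_power]]
    by blast
qed

end
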